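(* Let $q$ be a polynomial and let $p_1,p_2,\alpha_1,\alpha_2$ be nonzero complex constants with $\alpha_1\neq\alpha_2$. Suppose $f$ is an entire function with $\rho_2(f)<1$ satisfying $$f(z)^2+q(z)\,(f(z+1)-f(z))=p_1e^{\alpha_1 z}+p_2e^{\alpha_2 z}$$ and $N(r,1/f)=S(r,f)$. Then $q$ is a constant and one of the following holds: (1) $f(z)=c_1e^{\alpha_1 z/2}$ with $c_1^2=p_1$, $c_1\left(e^{\alpha_1/2}-1\right)q=p_2$ and $\alpha_1=2\alpha_2$; (2) $f(z)=c_2e^{\alpha_2 z/2}$ with $c_2^2=p_2$, $c_2\left(e^{\alpha_2/2}-1\right)q=p_1$ and $\alpha_2=2\alpha_1$.
   Context: Standard Nevanlinna notation: $T(r,f)$ is the characteristic function and $N(r,1/f)$ the integrated counting function of zeros of $f$ (counted with multiplicity). $S(r,f)$ denotes any quantity with $S(r,f)=o(T(r,f))$ as $r\to\infty$, possibly outside a set of finite logarithmic measure. The hyper-order is $\rho_2(f)=\limsup_{r\to\infty}\frac{\log\log T(r,f)}{\log r}$. *)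

theory Defs
  imports "HOL-Complex_Analysis.Complex_Analysis" "HOL-Computational_Algebra.Polynomial"
begin

text \<open>Nevanlinna characteristic of an entire function: T(r,f) = m(r,f) = (1/2pi) int_0^{2pi} log+ |f(r e^{i theta})| d theta
  (the counting function of poles N(r,f) vanishes for entire f).\<close>
definition nev_T :: "(complex \<Rightarrow> complex) \<Rightarrow> real \<Rightarrow> real" where
  "nev_T f r = (1 / (2 * pi)) *
     integral {0..2*pi} (\<lambda>\<theta>. max 0 (ln (cmod (f (complex_of_real r * cis \<theta>)))))"

definition zero_count :: "(complex \<Rightarrow> complex) \<Rightarrow> real \<Rightarrow> real" where
  "zero_count f t = (\<Sum>z\<in>{z. cmod z \<le> t \<and> f z = 0}. real_of_int (zorder f z))"

definition nev_N_zeros :: "(complex \<Rightarrow> complex) \<Rightarrow> real \<Rightarrow> real" where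
  "nev_N_zeros f r = integral {0..r} (\<lambda>t. (zero_count f t - zero_count f 0) / t)
                     + zero_count f 0 * ln r"

definition finite_log_measure :: "real set \<Rightarrow> bool" where
  "finite_log_measure E \<longleftrightarrow> E \<in> sets lborel \<and> E \<subseteq> {1..} \<and>
     (\<integral>\<^sup>+ t. indicator E t / ennreal t \<partial>lborel) < \<infinity>"

definition small_wrt :: "(real \<Rightarrow> real) \<Rightarrow> (complex \<Rightarrow> complex) \<Rightarrow> bool" where
  "small_wrt g f \<longleftrightarrow> (\<exists>E. finite_log_measure E \<and>
     (\<forall>\<epsilon>>0. \<exists>R. \<forall>r\<ge>R. r \<notin> E \<longrightarrow> \<bar>g r\<bar> \<le> \<epsilon> * nev_T f r))"

definition hyper_order :: "(complex \<Rightarrow> complex) \<Rightarrow> ereal" where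
  "hyper_order f = Limsup at_top (\<lambda>r. ereal (ln (ln (nev_T f r)) / ln r))"

end

theory Submission
  imports Defs
begin

text \<open>
  Let \<open>D\<close> be the second-order operator with constant coefficients that annihilates both
  exponentials, and let \<open>h\<close> be the difference term, so that \<open>W = D(f\<^sup>2) = - D(h)\<close>. The quotients
  \<open>W / f\<^sup>2\<close> and \<open>W / f\<close> are built from values of \<open>f\<close> at distance at most 2 divided by \<open>f(z)\<close>, so
  both have small proximity functions. If \<open>W\<close> were not identically zero, bounding \<open>log |W|\<close> by
  \<open>log |f|\<close> where \<open>|f| \<ge> 1\<close> and by \<open>2 log |f|\<close> elsewhere would give, by Jensen's formula for \<open>W\<close>
  and for \<open>f\<close>, \<open>T(r,f) \<le> 2 N(r,1/f) + o(r)\<close>, whereas \<open>T(r,f)\<close> grows at least linearly. Hence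
  \<open>D(f\<^sup>2) = 0\<close>: \<open>f\<^sup>2\<close> is a combination of the two exponentials, and being a square it is a
  multiple of one of them.

  The logarithmic derivative lemma and its difference analogue are not needed in general: along the
  orbit \<open>z + n\<close> the equation squares \<open>|f|\<close> at each step once \<open>|f|\<close> is too large, so hyper-order
  less than 1 forces \<open>f\<close> to be of exponential type. After division by its zeros, \<open>f\<close> is controlled by
  the Borel-Caratheodory inequality.
\<close>

section \<open>Circle means and the Poisson integral\<close>

text \<open>The contradiction is drawn at a single large radius. A set of finite logarithmic measure
  together with the countably many moduli of zeros of \<open>f\<close> and \<open>W\<close> leaves
  arbitrarily large radii free, and on such a circle all logarithms are continuous, so every circle
  mean is an honest integral. What has to be won is an error below the linear growth of T. The
  obstacle is that a zero \<open>a\<close> of \<open>f\<close> may lie arbitrarily close to the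
  circle, where no uniform pointwise bound for f(w)/f(z) survives. Its contribution is at most ln(1
  + 2/|z - a|), though, and this has mean O(1/sqrt r) uniformly in \<open>a\<close>; exponential
  type allows only O(r) zeros in a disc of radius comparable to r, so together they cost O(sqrt r).
  The polynomial costs \<epsilon> r with \<epsilon> at choice, and \<epsilon> is taken as a fraction
  of the growth rate of T. Since N(r,1/f) is eventually at most T/4 off the exceptional set, the
  term 2 N uses up half of T; the other half is still linear in r and has no counterpart
  left.\<close>

definition circle_mean :: "(complex \<Rightarrow> real) \<Rightarrow> real \<Rightarrow> real" where
  "circle_mean u r = (1 / (2 * pi)) * integral {0..2*pi} (\<lambda>\<theta>. u (complex_of_real r * cis \<theta>))"

lemma nev_T_eq_circle_mean: "nev_T f r = circle_mean (\<lambda>z. max 0 (ln (cmod (f z)))) r"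
  by (simp add: nev_T_def circle_mean_def)

lemma continuous_on_circle:
  fixes u :: "complex \<Rightarrow> real"
  assumes "continuous_on (sphere 0 r) u" "r \<ge> 0"
  shows "continuous_on A (\<lambda>\<theta>. u (complex_of_real r * cis \<theta>))"
  by (rule continuous_on_compose2[OF assms(1)])
     (use assms(2) in \<open>auto intro!: continuous_intros simp: norm_mult\<close>)

lemma circle_mean_mono:
  assumes "continuous_on (sphere 0 r) u" "continuous_on (sphere 0 r) v" "r \<ge> 0"
    and "\<And>z. cmod z = r \<Longrightarrow> u z \<le> v z"
  shows "circle_mean u r \<le> circle_mean v r"
  unfolding circle_mean_def
  by (intro mult_left_mono integral_le integrable_continuous_real continuous_on_circle)
     (use assms in \<open>auto simp: norm_mult\<close>)

lemma circle_mean_cong: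
  assumes "r \<ge> 0" "\<And>z. cmod z = r \<Longrightarrow> u z = v z"
  shows "circle_mean u r = circle_mean v r"
  unfolding circle_mean_def using assms by (simp add: norm_mult)

lemma circle_mean_add:
  assumes "continuous_on (sphere 0 r) u" "continuous_on (sphere 0 r) v" "r \<ge> 0"
  shows "circle_mean (\<lambda>z. u z + v z) r = circle_mean u r + circle_mean v r"
  unfolding circle_mean_def
  by (subst integral_add)
     (use continuous_on_circle[OF assms(1,3)] continuous_on_circle[OF assms(2,3)]
      in \<open>simp_all add: integrable_continuous_real distrib_left\<close>)

lemma circle_mean_cmult: "circle_mean (\<lambda>z. c * u z) r = c * circle_mean u r"
  by (simp add: circle_mean_def)

lemma circle_mean_const [simp]: "circle_mean (\<lambda>z. c) r = c"
  by (simp add: circle_mean_def)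

lemma circle_mean_sum:
  assumes "\<And>i. i \<in> I \<Longrightarrow> continuous_on (sphere 0 r) (u i)" "r \<ge> 0"
  shows "circle_mean (\<lambda>z. \<Sum>i\<in>I. u i z) r = (\<Sum>i\<in>I. circle_mean (u i) r)"
proof (cases "finite I")
  case True
  then show ?thesis using assms
  proof (induction I)
    case (insert i I)
    then show ?case
      by (simp add: circle_mean_add continuous_on_sum)
  qed simp
qed simp

text \<open>The logarithm must live on a neighbourhood of the closed disc, as the Poisson formula
  integrates it over the boundary. The zero set is closed, so a zero nearest to the origin
  determines the larger radius.\<close>

lemma exists_log_on_larger_ball:
  assumes g: "g holomorphic_on UNIV" and nz: "\<And>z. z \<in> cball 0 r \<Longrightarrow> g z \<noteq> 0" and r: "r > 0"
  obtains L e where "e > r" "L holomorphic_on ball 0 e" "\<And>z. z \<in> ball 0 e \<Longrightarrow> g z = exp (L z)"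
proof -
  define C where "C = {z. g z = 0}"
  have clC: "closed C"
    unfolding C_def
    by (rule closed_Collect_eq) (use g in \<open>auto intro: holomorphic_on_imp_continuous_on\<close>)
  obtain e where e: "e > r" "\<And>z. z \<in> ball 0 e \<Longrightarrow> g z \<noteq> 0"
  proof (cases "C = {}")
    case True
    then show ?thesis using that[of "r+1"] by (auto simp: C_def)
  next
    case False
    obtain x where x: "x \<in> C" "\<And>y. y \<in> C \<Longrightarrow> dist 0 x \<le> dist 0 y"
      using distance_attains_inf[OF clC False] by blast
    have "cmod x > r" using nz[of x] x(1) by (force simp: C_def)
    then show ?thesis using that[of "cmod x"] x(2) by (force simp: C_def)
  qed
  have "g holomorphic_on ball 0 e" using g by (rule holomorphic_on_subset) auto
  then obtain L where "L holomorphic_on ball 0 e" "\<And>z. z \<in> ball 0 e \<Longrightarrow> g z = exp (L z)"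
    using contractible_imp_holomorphic_log[of g "ball 0 e"] e(2) convex_imp_contractible[OF convex_ball]
    by metis
  then show ?thesis using that e(1) by blast
qed

text \<open>Cauchy's formula at \<open>z\<close> is combined with Cauchy's theorem for a second
  kernel whose pole is the reflection of \<open>z\<close> in the circle, hence outside the disc. On
  the circle the two kernels add up to the Poisson kernel. No conjugate of \<open>L\<close> occurs,
  so real parts can be taken afterwards.\<close>

lemma Poisson_integral_disc:
  fixes L :: "complex \<Rightarrow> complex"
  assumes L: "L holomorphic_on ball 0 e" and r: "0 < r" "r < e" and z: "cmod z < r"
  shows "((\<lambda>\<theta>. of_real ((r\<^sup>2 - (cmod z)\<^sup>2) / (cmod (r * cis \<theta> - z))\<^sup>2) * L (r * cis \<theta>))
           has_integral (2 * pi * L z)) {0..2*pi}"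
proof -
  have LU: "L holomorphic_on cball 0 r" using L by (rule holomorphic_on_subset) (use r in auto)
  have int1: "((\<lambda>u. L u / (u - z)) has_contour_integral (2 * of_real pi * \<i> * L z)) (circlepath 0 r)"
    by (rule Cauchy_integral_circlepath)
       (use LU z in \<open>auto intro: holomorphic_on_imp_continuous_on holomorphic_on_subset\<close>)
  \<comment> \<open>The reflected point has modulus \<open>r\<^sup>2 / cmod z\<close>, which exceeds
    \<open>r\<close>; for \<open>z = 0\<close> there is none. The second kernel is holomorphic up to
    \<open>B\<close>.\<close>
  define B where "B = (if z = 0 then e else min e (r\<^sup>2 / cmod z))"
  have B: "r < B" "B \<le> e"
    using r z by (auto simp: B_def field_simps power2_eq_square)
  have nz: "r\<^sup>2 - cnj z * u \<noteq> 0" if "u \<in> ball 0 B" for u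
  proof
    assume eq: "r\<^sup>2 - cnj z * u = 0"
    then have "r\<^sup>2 = cmod (cnj z * u)"
      by (metis eq_iff_diff_eq_0 norm_of_real abs_power2 of_real_power)
    then have "r\<^sup>2 = cmod z * cmod u" by (simp add: norm_mult)
    moreover from this r have "z \<noteq> 0" by auto
    ultimately show False using that r by (auto simp: B_def field_simps)
  qed
  have int2: "((\<lambda>u. L u * cnj z / (r\<^sup>2 - cnj z * u)) has_contour_integral 0) (circlepath 0 r)"
  proof (rule Cauchy_theorem_convex_simple[of _ "ball 0 B"])
    show "(\<lambda>u. L u * cnj z / (r\<^sup>2 - cnj z * u)) holomorphic_on ball 0 B"
      by (intro holomorphic_intros holomorphic_on_subset[OF L]) (use B nz in auto)
  qed (use B r in \<open>auto simp: path_image_circlepath\<close>)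
  have "((\<lambda>u. L u / (u - z) + L u * cnj z / (r\<^sup>2 - cnj z * u)) has_contour_integral
      (2 * of_real pi * \<i> * L z)) (part_circlepath 0 r 0 (2*pi))"
    using has_contour_integral_add[OF int1 int2] by (simp add: circlepath_def)
  then have "((\<lambda>t. (L (0 + r * cis t) / ((0 + r * cis t) - z) + L (0 + r * cis t) * cnj z / (r\<^sup>2 - cnj z * (0 + r * cis t))) * r * \<i> * cis t)
      has_integral (2 * of_real pi * \<i> * L z)) {0..2*pi}"
    by (subst (asm) has_contour_integral_part_circlepath_iff) auto
  then have "((\<lambda>t. (-\<i>) * ((L (0 + r * cis t) / ((0 + r * cis t) - z) + L (0 + r * cis t) * cnj z / (r\<^sup>2 - cnj z * (0 + r * cis t))) * r * \<i> * cis t))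
      has_integral (-\<i>) * (2 * of_real pi * \<i> * L z)) {0..2*pi}"
    by (rule has_integral_mult_right)
  moreover have "(-\<i>) * ((L (0 + r * cis t) / ((0 + r * cis t) - z) + L (0 + r * cis t) * cnj z / (r\<^sup>2 - cnj z * (0 + r * cis t))) * r * \<i> * cis t)
     = of_real ((r\<^sup>2 - (cmod z)\<^sup>2) / (cmod (r * cis t - z))\<^sup>2) * L (r * cis t)" for t
  proof -
    define u where "u = cis t"
    have u: "u * cnj u = 1" "u \<noteq> 0" by (auto simp: u_def cis_cnj cis_mult)
    have n1: "r * u - z \<noteq> 0"
    proof
      assume "r * u - z = 0"
      then have "cmod z = cmod (r * u)" by simp
      then show False using z r by (simp add: norm_mult u_def)
    qed
    have n2: "r - cnj z * u \<noteq> 0"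
    proof
      assume "r - cnj z * u = 0"
      then have "r = cmod (cnj z * u)" using r by (metis abs_of_pos eq_iff_diff_eq_0 norm_of_real)
      then show False using z by (simp add: norm_mult u_def)
    qed
    have sq: "(complex_of_real (cmod (r * u - z)))\<^sup>2 = (r * u - z) * (r * cnj u - cnj z)"
      by (simp only: of_real_power[symmetric] complex_norm_square) simp
    have sq2: "(r * u - z) * (r * cnj u - cnj z) * u = (r * u - z) * (r - cnj z * u)"
    proof -
      have "(r * cnj u - cnj z) * u = r * (u * cnj u) - cnj z * u" by (simp add: algebra_simps)
      then show ?thesis unfolding u(1) by (simp only: mult.assoc mult_1_right)
    qed
    have n3: "(r * u - z) * (r * cnj u - cnj z) \<noteq> 0" using n1 sq by (metis norm_eq_zero of_real_eq_0_iff power_eq_0_iff)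
    have rr: "r\<^sup>2 - cnj z * (r * u) = r * (r - cnj z * u)" by (simp add: algebra_simps power2_eq_square)
    have "(1 / (r * u - z) + cnj z / (r\<^sup>2 - cnj z * (r * u))) * r * u
       = (r * (r - cnj z * u) + cnj z * (r * u - z)) * u / ((r * u - z) * (r - cnj z * u))"
      unfolding rr using n1 n2 r by (simp add: add_frac_eq)
    also have "\<dots> = (r\<^sup>2 - z * cnj z) * u / ((r * u - z) * (r * cnj u - cnj z) * u)"
      unfolding sq2 by (simp add: algebra_simps power2_eq_square)
    also have "\<dots> = (r\<^sup>2 - z * cnj z) / ((r * u - z) * (r * cnj u - cnj z))"
      using u by simp
    also have "\<dots> = of_real ((r\<^sup>2 - (cmod z)\<^sup>2) / (cmod (r * u - z))\<^sup>2)"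
      by (simp add: sq[symmetric] complex_norm_square[symmetric])
    finally have key: "(1 / (r * u - z) + cnj z / (r\<^sup>2 - cnj z * (r * u))) * r * u = \<dots>" .
    have "(-\<i>) * ((L (0 + r * u) / ((0 + r * u) - z) + L (0 + r * u) * cnj z / (r\<^sup>2 - cnj z * (0 + r * u))) * r * \<i> * u)
      = ((1 / (r * u - z) + cnj z / (r\<^sup>2 - cnj z * (r * u))) * r * u) * L (r * u)"
      by (simp add: algebra_simps add_divide_distrib)
    then show ?thesis unfolding key unfolding u_def .
  qed
  ultimately show ?thesis by (simp add: mult_ac)
qed

lemma circle_mean_Re_holomorphic:
  fixes L :: "complex \<Rightarrow> complex"
  assumes L: "L holomorphic_on ball 0 e" and r: "0 < r" "r < e"
  shows "circle_mean (\<lambda>z. Re (L z)) r = Re (L 0)"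
proof -
  have "((\<lambda>\<theta>. L (r * cis \<theta>)) has_integral (2 * pi * L 0)) {0..2*pi}"
    using Poisson_integral_disc[OF L r, of 0] r by (simp add: norm_mult)
  from has_integral_Re[OF this] show ?thesis
    by (simp add: circle_mean_def integral_unique)
qed

text \<open>For |z| \<le> r/2 the Poisson kernel is at most (r + |z|)/(r - |z|) \<le> 3. This 3 is
  the one in the later bounds \<open>exp (3 * nev_T f r)\<close>.\<close>

lemma Re_le_circle_mean_positive_part:
  fixes L :: "complex \<Rightarrow> complex"
  assumes L: "L holomorphic_on ball 0 e" and r: "0 < r" "r < e" and z: "cmod z \<le> r / 2"
  shows "Re (L z) \<le> 3 * circle_mean (\<lambda>z. max 0 (Re (L z))) r"
proof -
  have z': "cmod z < r" using z r by simp
  have cont: "continuous_on (sphere 0 r) (\<lambda>z. max 0 (Re (L z)))"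
    by (intro continuous_intros holomorphic_on_imp_continuous_on[OF holomorphic_on_subset[OF L]])
       (use r in auto)
  let ?P = "\<lambda>\<theta>. (r\<^sup>2 - (cmod z)\<^sup>2) / (cmod (r * cis \<theta> - z))\<^sup>2"
  have 1: "((\<lambda>\<theta>. ?P \<theta> * Re (L (r * cis \<theta>))) has_integral (2 * pi * Re (L z))) {0..2*pi}"
    using has_integral_Re[OF Poisson_integral_disc[OF L r z']] by simp
  have 2: "((\<lambda>\<theta>. 3 * max 0 (Re (L (r * cis \<theta>)))) has_integral
     3 * integral {0..2*pi} (\<lambda>\<theta>. max 0 (Re (L (r * cis \<theta>))))) {0..2*pi}"
    by (intro has_integral_mult_right integrable_integral integrable_continuous_real
        continuous_on_circle cont) (use r in auto)
  have le: "?P \<theta> * Re (L (r * cis \<theta>)) \<le> 3 * max 0 (Re (L (r * cis \<theta>)))" for \<theta>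
  proof -
    have d: "cmod (r * cis \<theta> - z) \<ge> r - cmod z"
      using norm_triangle_ineq2[of "r * cis \<theta>" z] r by (simp add: norm_mult)
    have pos: "?P \<theta> \<ge> 0" using z' by (auto intro!: divide_nonneg_nonneg power_mono)
    have "?P \<theta> \<le> (r\<^sup>2 - (cmod z)\<^sup>2) / (r - cmod z)\<^sup>2"
      by (rule divide_left_mono) (use d z' in \<open>auto intro!: power_mono mult_pos_pos zero_less_power\<close>)
    also have "\<dots> = (r + cmod z) / (r - cmod z)"
      using z' by (simp add: power2_eq_square divide_simps) (simp add: algebra_simps)
    also have "\<dots> \<le> 3" using z z' by (simp add: divide_simps)
    finally have "?P \<theta> \<le> 3" .
    then have "?P \<theta> * max 0 (Re (L (r * cis \<theta>))) \<le> 3 * max 0 (Re (L (r * cis \<theta>)))"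
      by (rule mult_right_mono) simp
    moreover have "?P \<theta> * Re (L (r * cis \<theta>)) \<le> ?P \<theta> * max 0 (Re (L (r * cis \<theta>)))"
      by (rule mult_left_mono[OF _ pos]) simp
    ultimately show ?thesis by linarith
  qed
  have "2 * pi * Re (L z) \<le> 3 * integral {0..2*pi} (\<lambda>\<theta>. max 0 (Re (L (r * cis \<theta>))))"
    using has_integral_le[OF 1 2] le by blast
  then show ?thesis by (simp add: circle_mean_def field_simps)
qed

section \<open>Zeros, Jensen's formula and the characteristic\<close>

text \<open>\<open>zorder\<close> is an integer; multiplicities are needed as exponents. For an
  entire function that is not identically zero the value at a non-zero is 0, so products over any
  finite set are harmless.\<close>

definition zero_mult :: "(complex \<Rightarrow> complex) \<Rightarrow> complex \<Rightarrow> nat" where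
  "zero_mult f a = nat (zorder f a)"

definition zeros_upto :: "(complex \<Rightarrow> complex) \<Rightarrow> real \<Rightarrow> complex set" where
  "zeros_upto f r = {a. cmod a \<le> r \<and> f a = 0}"

text \<open>Used for the solution \<open>f\<close> and, inside the contradiction argument, for
  \<open>W\<close>.\<close>

locale nonzero_entire =
  fixes f :: "complex \<Rightarrow> complex"
  assumes holo: "f holomorphic_on UNIV" and nonzero: "\<exists>w. f w \<noteq> 0"
begin

lemma zorder_cases: "if f a = 0 then zorder f a > 0 else zorder f a = 0"
  using zorder_exist_zero[of f UNIV a] holo nonzero by (auto simp: connected_UNIV)

lemma zorder_eq_zero_mult: "zorder f a = int (zero_mult f a)"
  using zorder_cases[of a] by (auto simp: zero_mult_def split: if_splits)

lemma zero_mult_eq_0_iff: "zero_mult f a = 0 \<longleftrightarrow> f a \<noteq> 0"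
  using zorder_cases[of a] by (auto simp: zero_mult_def split: if_splits)

lemma local_factor:
  obtains h e where "e > 0" "h holomorphic_on ball a e" "h a \<noteq> 0"
    "\<And>z. z \<in> ball a e \<Longrightarrow> f z = (z - a) ^ zero_mult f a * h z"
proof -
  from zorder_exist_zero[of f UNIV a] holo nonzero
  obtain r where r: "r > 0" "zor_poly f a holomorphic_on cball a r"
     "\<forall>w\<in>cball a r. f w = zor_poly f a w * (w - a) ^ nat (zorder f a) \<and> zor_poly f a w \<noteq> 0"
    by auto
  show ?thesis
    by (rule that[of r "zor_poly f a"])
       (use r in \<open>auto simp: zero_mult_def mult_ac intro: holomorphic_on_subset\<close>)
qed

section \<open>Dividing out zeros\<close>

lemma finite_zeros_upto: "finite (zeros_upto f r)"
proof (cases "f constant_on UNIV")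
  case True
  then have "zeros_upto f r = {}"
    using nonzero by (auto simp: zeros_upto_def constant_on_def)
  then show ?thesis by simp
next
  case False
  then have "finite {z \<in> cball 0 r. f z = 0}"
    by (intro holomorphic_compact_finite_zeros[of f UNIV] holo) auto
  also have "{z \<in> cball 0 r. f z = 0} = zeros_upto f r" by (auto simp: zeros_upto_def)
  finally show ?thesis .
qed

lemma countable_zeros: "countable {z. f z = 0}"
proof -
  have "{z. f z = 0} = (\<Union>n::nat. zeros_upto f (real n))"
    by (auto simp: zeros_upto_def real_arch_simple)
  then show ?thesis by (simp add: finite_zeros_upto countable_finite)
qed

text \<open>Zeros are divided out one at a time. The new quotient is holomorphic off
  \<open>a\<close>, and near \<open>a\<close> it agrees with \<open>h / P\<close>, where
  \<open>h\<close> is the local cofactor of \<open>f\<close>; gluing the two descriptions removes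
  the singularity without an appeal to boundedness.\<close>

lemma factor_zeros:
  assumes "finite Z"
  shows "\<exists>g. g holomorphic_on UNIV \<and> (\<forall>z. f z = (\<Prod>a\<in>Z. (z - a) ^ zero_mult f a) * g z)
            \<and> (\<forall>a\<in>Z. g a \<noteq> 0)"
  using assms
proof (induction Z)
  case empty
  then show ?case using holo by auto
next
  case (insert a Z)
  then obtain g where g: "g holomorphic_on UNIV"
    "\<And>z. f z = (\<Prod>a\<in>Z. (z - a) ^ zero_mult f a) * g z" "\<And>a. a \<in> Z \<Longrightarrow> g a \<noteq> 0"
    by blast
  define P where "P z = (\<Prod>a\<in>Z. (z - a) ^ zero_mult f a)" for z
  define n where "n = zero_mult f a"
  obtain h e where h: "e > 0" "h holomorphic_on ball a e" "h a \<noteq> 0"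
    "\<And>z. z \<in> ball a e \<Longrightarrow> f z = (z - a) ^ n * h z"
    using local_factor unfolding n_def by metis
  have P0: "P z \<noteq> 0" if "z \<notin> Z" for z
    using that insert.hyps by (auto simp: P_def)
  have Ph: "P holomorphic_on A" for A
    unfolding P_def by (intro holomorphic_intros)
  define S where "S = ball a e - Z"
  have oS: "open S" unfolding S_def using insert.hyps by (intro open_Diff finite_imp_closed) auto
  have aS: "a \<in> S" using h insert.hyps by (auto simp: S_def)
  define g' where "g' z = (if z = a then h a / P a else g z / (z - a) ^ n)" for z
  have eqS: "g' z = h z / P z" if "z \<in> S" for z
  proof (cases "z = a")
    case False
    have "P z * g z = (z - a) ^ n * h z"
      using h(4)[of z] g(2)[of z] that by (auto simp: S_def P_def)
    with False P0[of z] that show ?thesis by (auto simp: g'_def S_def field_simps)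
  qed (simp add: g'_def)
  have "(\<lambda>z. h z / P z) holomorphic_on S"
    by (intro holomorphic_intros Ph holomorphic_on_subset[OF h(2)]) (auto simp: S_def P0)
  then have 1: "g' holomorphic_on S" by (rule holomorphic_transform) (simp add: eqS)
  have "(\<lambda>z. g z / (z - a) ^ n) holomorphic_on - {a}"
    by (intro holomorphic_intros holomorphic_on_subset[OF g(1)]) auto
  then have 2: "g' holomorphic_on - {a}"
    by (rule holomorphic_transform) (simp add: g'_def)
  have "g' holomorphic_on S \<union> - {a}" by (rule holomorphic_on_Un) (use oS 1 2 in auto)
  moreover have "S \<union> - {a} = UNIV" using aS by auto
  ultimately have "g' holomorphic_on UNIV" by simp
  moreover have "f z = (\<Prod>a\<in>insert a Z. (z - a) ^ zero_mult f a) * g' z" for z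
  proof (cases "z = a")
    case True
    then show ?thesis
      using h(4)[of a] P0[of a] insert.hyps h(1)
      by (auto simp: g'_def n_def P_def[symmetric])
  next
    case False
    then show ?thesis using insert.hyps g(2)[of z] by (simp add: g'_def n_def)
  qed
  moreover have "g' b \<noteq> 0" if "b \<in> insert a Z" for b
    using that h(3) P0[of a] insert.hyps g(3)[of b] by (auto simp: g'_def)
  ultimately show ?case by blast
qed

lemma zeros_upto_factor:
  obtains g where "g holomorphic_on UNIV"
    "\<And>z. f z = (\<Prod>a\<in>zeros_upto f r. (z - a) ^ zero_mult f a) * g z"
    "\<And>z. cmod z \<le> r \<Longrightarrow> g z \<noteq> 0"
proof -
  obtain g where g: "g holomorphic_on UNIV"
    "\<And>z. f z = (\<Prod>a\<in>zeros_upto f r. (z - a) ^ zero_mult f a) * g z"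
    "\<And>a. a \<in> zeros_upto f r \<Longrightarrow> g a \<noteq> 0"
    using factor_zeros[OF finite_zeros_upto[of r]] by blast
  have "g z \<noteq> 0" if "cmod z \<le> r" for z
    using g(2)[of z] g(3)[of z] that by (auto simp: zeros_upto_def)
  with g that show ?thesis by blast
qed

text \<open>\<open>c\<close> is the modulus of the first nonzero Taylor coefficient of
  \<open>f\<close> at 0. It is quantified before \<open>Z\<close> and \<open>g\<close> because both
  will vary with the radius while the constant must not.\<close>

lemma leading_coefficient:
  "\<exists>c>0. \<forall>Z g. finite Z \<longrightarrow> (f 0 = 0 \<longrightarrow> 0 \<in> Z) \<longrightarrow> g holomorphic_on UNIV \<longrightarrow>
     (\<forall>z. f z = (\<Prod>a\<in>Z. (z - a) ^ zero_mult f a) * g z) \<longrightarrow>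
     c = (\<Prod>a\<in>Z - {0}. cmod a ^ zero_mult f a) * cmod (g 0)"
proof -
  obtain f1 where f1: "f1 holomorphic_on UNIV" "\<And>z. f z = z ^ zero_mult f 0 * f1 z" "f1 0 \<noteq> 0"
    using factor_zeros[of "{0}"] by auto
  have "cmod (f1 0) = (\<Prod>a\<in>Z - {0}. cmod a ^ zero_mult f a) * cmod (g 0)"
    if Z: "finite Z" "f 0 = 0 \<longrightarrow> 0 \<in> Z" and g: "g holomorphic_on UNIV"
     "\<And>z. f z = (\<Prod>a\<in>Z. (z - a) ^ zero_mult f a) * g z" for Z g
  proof -
    define h where "h z = (\<Prod>a\<in>Z - {0}. (z - a) ^ zero_mult f a) * g z" for z
    have hh: "h holomorphic_on UNIV" unfolding h_def by (intro holomorphic_intros g(1))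
    have fh: "f z = z ^ zero_mult f 0 * h z" for z
    proof (cases "0 \<in> Z")
      case True
      then show ?thesis using Z(1) g(2)[of z] by (simp add: h_def prod.remove[of Z 0])
    next
      case False
      with Z zero_mult_eq_0_iff[of 0] g(2)[of z] show ?thesis by (simp add: h_def)
    qed
    have "f1 z = h z" if "z \<noteq> 0" for z using fh[of z] f1(2)[of z] that by simp
    moreover have "isCont k 0" if "k holomorphic_on UNIV" for k :: "complex \<Rightarrow> complex"
      using holomorphic_on_imp_continuous_on[OF that] continuous_on_eq_continuous_at[OF open_UNIV] by blast
    then have "isCont f1 0" "isCont h 0"
      using f1(1) hh by blast+
    ultimately have "f1 \<midarrow>0\<rightarrow> h 0"
      using LIM_equal[of 0 f1 h "h 0"] by (simp add: isCont_def)
    with \<open>isCont f1 0\<close> have "f1 0 = h 0" using LIM_unique unfolding isCont_def by blast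
    then show ?thesis by (simp add: h_def norm_mult norm_power prod_norm[symmetric])
  qed
  with f1(3) show ?thesis by (intro exI[of _ "cmod (f1 0)"]) auto
qed

text \<open>Multiplying \<open>f\<close> by the reciprocals of the Blaschke factors of its zeros removes the zeros
  in the disc without changing \<open>|f|\<close> on the circle.\<close>

lemma Blaschke:
  assumes r: "r > 0" and nz: "\<And>z. cmod z = r \<Longrightarrow> f z \<noteq> 0"
  obtains L e g where "e > r" "L holomorphic_on ball 0 e" "g holomorphic_on UNIV"
    "\<And>z. f z = (\<Prod>a\<in>zeros_upto f r. (z - a) ^ zero_mult f a) * g z" "g 0 \<noteq> 0"
    "\<And>z. cmod z = r \<Longrightarrow> Re (L z) = ln (cmod (f z))"
    "\<And>z. cmod z < r \<Longrightarrow> cmod (f z) \<le> exp (Re (L z))"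
    "Re (L 0) = (\<Sum>a\<in>zeros_upto f r. real (zero_mult f a) * ln r) + ln (cmod (g 0))"
proof -
  obtain g where g: "g holomorphic_on UNIV"
    "\<And>z. f z = (\<Prod>a\<in>zeros_upto f r. (z - a) ^ zero_mult f a) * g z"
    "\<And>z. cmod z \<le> r \<Longrightarrow> g z \<noteq> 0"
    using zeros_upto_factor by blast
  \<comment> \<open>Strictness comes from the zero-free circle. It keeps the reflected points of the
    zeros outside the closed disc, so \<open>F\<close> has no zeros there and admits a
    logarithm.\<close>
  have Z: "cmod a < r" if "a \<in> zeros_upto f r" for a
    using that nz[of a] by (force simp: zeros_upto_def)
  define F where "F z = (\<Prod>a\<in>zeros_upto f r. ((r\<^sup>2 - cnj a * z) / r) ^ zero_mult f a) * g z" for z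
  have Fh: "F holomorphic_on UNIV"
    unfolding F_def by (intro holomorphic_intros g(1)) (use r in auto)
  have F1: "cmod (z - a) \<le> cmod ((r\<^sup>2 - cnj a * z) / r)" if "a \<in> zeros_upto f r" "cmod z \<le> r" for a z
  proof -
    have "(cmod (r\<^sup>2 - cnj a * z))\<^sup>2 - (r * cmod (z - a))\<^sup>2 = (r\<^sup>2 - (cmod a)\<^sup>2) * (r\<^sup>2 - (cmod z)\<^sup>2)"
      unfolding power_mult_distrib cmod_power2
      by (simp add: algebra_simps power2_eq_square)
    moreover have "(cmod a)\<^sup>2 \<le> r\<^sup>2" "(cmod z)\<^sup>2 \<le> r\<^sup>2"
      using Z[OF that(1)] that(2) by (auto intro!: power_mono)
    ultimately have "(r * cmod (z - a))\<^sup>2 \<le> (cmod (r\<^sup>2 - cnj a * z))\<^sup>2"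
      using mult_nonneg_nonneg[of "r\<^sup>2 - (cmod a)\<^sup>2" "r\<^sup>2 - (cmod z)\<^sup>2"] by linarith
    then have "r * cmod (z - a) \<le> cmod (r\<^sup>2 - cnj a * z)" by (rule power2_le_imp_le) simp
    then show ?thesis using r by (simp add: norm_divide field_simps)
  qed
  have F2: "cmod (z - a) = cmod ((r\<^sup>2 - cnj a * z) / r)" if "cmod z = r" for a z
  proof -
    have "(cmod (r\<^sup>2 - cnj a * z))\<^sup>2 - (r * cmod (z - a))\<^sup>2 = (r\<^sup>2 - (cmod a)\<^sup>2) * (r\<^sup>2 - (cmod z)\<^sup>2)"
      unfolding power_mult_distrib cmod_power2
      by (simp add: algebra_simps power2_eq_square)
    then have "(r * cmod (z - a))\<^sup>2 = (cmod (r\<^sup>2 - cnj a * z))\<^sup>2" using that by simp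
    then have "r * cmod (z - a) = cmod (r\<^sup>2 - cnj a * z)" using r by (simp add: power2_eq_iff_nonneg)
    then show ?thesis using r by (simp add: norm_divide field_simps)
  qed
  have Fnz: "F z \<noteq> 0" if "z \<in> cball 0 r" for z
  proof -
    have "r\<^sup>2 - cnj a * z \<noteq> 0" if a: "a \<in> zeros_upto f r" for a
    proof
      assume "r\<^sup>2 - cnj a * z = 0"
      then have "cmod (of_real (r\<^sup>2)) = cmod (cnj a * z)" by simp
      then have "r * r = cmod a * cmod z" by (simp add: norm_mult norm_power power2_eq_square)
      moreover have "cmod a * cmod z \<le> cmod a * r" using \<open>z \<in> cball 0 r\<close> by (intro mult_left_mono) auto
      moreover have "cmod a * r < r * r" using Z[OF a] r by simp
      ultimately show False by linarith
    qed
    then show ?thesis using finite_zeros_upto g(3)[of z] that r by (auto simp: F_def)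
  qed
  obtain L e where L: "e > r" "L holomorphic_on ball 0 e" "\<And>z. z \<in> ball 0 e \<Longrightarrow> F z = exp (L z)"
    using exists_log_on_larger_ball[OF Fh Fnz r] by blast
  have nF: "cmod (F z) = exp (Re (L z))" if "cmod z \<le> r" for z
    using L(1) L(3)[of z] that by simp
  have 1: "Re (L z) = ln (cmod (f z))" if "cmod z = r" for z
  proof -
    have "cmod (F z) = cmod (f z)"
      unfolding F_def g(2)[of z] norm_mult prod_norm[symmetric] norm_power using F2[OF that] by simp
    then show ?thesis using nF[of z] that by (metis ln_exp order_refl)
  qed
  have 2: "cmod (f z) \<le> exp (Re (L z))" if "cmod z < r" for z
  proof -
    have "cmod (f z) \<le> cmod (F z)"
      unfolding F_def g(2)[of z] norm_mult prod_norm[symmetric] norm_power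
      by (intro mult_right_mono prod_mono) (use F1[of _ z] that in \<open>auto intro: power_mono\<close>)
    then show ?thesis using nF[of z] that by simp
  qed
  have "cmod (F 0) = (\<Prod>a\<in>zeros_upto f r. r ^ zero_mult f a) * cmod (g 0)"
    using r by (simp add: F_def norm_mult prod_norm[symmetric] norm_power power2_eq_square)
  then have "ln (cmod (F 0)) = ln (\<Prod>a\<in>zeros_upto f r. r ^ zero_mult f a) + ln (cmod (g 0))"
    by (simp only:) (rule ln_mult_pos; use r g(3)[of 0] in \<open>simp add: prod_pos\<close>)
  also have "ln (\<Prod>a\<in>zeros_upto f r. r ^ zero_mult f a) = (\<Sum>a\<in>zeros_upto f r. real (zero_mult f a) * ln r)"
    using r finite_zeros_upto by (simp add: ln_prod ln_realpow)
  finally have 3: "Re (L 0) = (\<Sum>a\<in>zeros_upto f r. real (zero_mult f a) * ln r) + ln (cmod (g 0))"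
    using nF[of 0] r by simp
  show ?thesis using that[OF L(1,2) g(1,2) _ 1 2 3] g(3)[of 0] r by auto
qed

lemma continuous_ln_circle:
  assumes "\<And>z. cmod z = r \<Longrightarrow> f z \<noteq> 0"
  shows "continuous_on (sphere 0 r) (\<lambda>z. ln (cmod (f z)))"
  by (intro continuous_intros holomorphic_on_imp_continuous_on holomorphic_on_subset[OF holo])
     (use assms in auto)

text \<open>log |f| lies below the harmonic function Re \<open>L\<close> in the disc and equals it
  on the circle, so the mean of the positive part of Re \<open>L\<close> is exactly T.\<close>

lemma norm_le_exp_nev_T:
  assumes r: "r > 0" and nz: "\<And>z. cmod z = r \<Longrightarrow> f z \<noteq> 0" and w: "cmod w \<le> r / 2"
  shows "cmod (f w) \<le> exp (3 * nev_T f r)"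
proof -
  obtain L e g where L: "e > r" "L holomorphic_on ball 0 e" 
    "\<And>z. cmod z = r \<Longrightarrow> Re (L z) = ln (cmod (f z))"
    "\<And>z. cmod z < r \<Longrightarrow> cmod (f z) \<le> exp (Re (L z))"
    using Blaschke[OF r nz] by metis
  have "cmod (f w) \<le> exp (Re (L w))" using L(4) w r by simp
  also have "Re (L w) \<le> 3 * circle_mean (\<lambda>z. max 0 (Re (L z))) r"
    by (rule Re_le_circle_mean_positive_part[OF L(2) r L(1) w])
  also have "circle_mean (\<lambda>z. max 0 (Re (L z))) r = nev_T f r"
    unfolding nev_T_eq_circle_mean by (rule circle_mean_cong) (use r L(3) in auto)
  finally show ?thesis by simp
qed

text \<open>A zero \<open>a\<close> other than 0 enters the count at t = |a|, so the integral splits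
  into finitely many integrals of 1/t over [|a|, r].\<close>

lemma nev_N_zeros_eq:
  assumes r: "r > 0"
  shows "nev_N_zeros f r =
    (\<Sum>a\<in>zeros_upto f r - {0}. real (zero_mult f a) * ln (r / cmod a)) + real (zero_mult f 0) * ln r"
proof -
  have zc: "zero_count f t = (\<Sum>a\<in>zeros_upto f t. real (zero_mult f a))" for t
    unfolding zero_count_def zeros_upto_def by (simp add: zorder_eq_zero_mult)
  have zc0: "zero_count f 0 = real (zero_mult f 0)"
  proof (cases "f 0 = 0")
    case True
    then have "zeros_upto f 0 = {0}" by (auto simp: zeros_upto_def)
    then show ?thesis by (simp add: zc)
  next
    case False
    then have "zeros_upto f 0 = {}" by (auto simp: zeros_upto_def)
    then show ?thesis using False by (simp add: zc zero_mult_eq_0_iff)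
  qed
  define Z where "Z = zeros_upto f r - {0}"
  have fZ: "finite Z" unfolding Z_def using finite_zeros_upto by simp
  have eq: "(zero_count f t - zero_count f 0) / t
     = (\<Sum>a\<in>Z. real (zero_mult f a) * (if t \<in> {cmod a..r} then 1 / t else 0))" if "t \<in> {0..r}" for t
  proof -
    have "zero_count f t - zero_count f 0 = (\<Sum>a\<in>zeros_upto f t - {0}. real (zero_mult f a))"
    proof (cases "f 0 = 0")
      case True
      then have "0 \<in> zeros_upto f t" using that by (simp add: zeros_upto_def)
      then show ?thesis unfolding zc0 zc[of t]
        using finite_zeros_upto by (simp add: sum.remove[of _ 0])
    next
      case False
      then have "0 \<notin> zeros_upto f t" by (simp add: zeros_upto_def)
      then show ?thesis unfolding zc0 zc[of t] using False by (simp add: zero_mult_eq_0_iff)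
    qed
    also have "zeros_upto f t - {0} = {a\<in>Z. cmod a \<le> t}"
      using that by (auto simp: Z_def zeros_upto_def)
    also have "(\<Sum>a\<in>{a\<in>Z. cmod a \<le> t}. real (zero_mult f a)) =
       (\<Sum>a\<in>Z. if cmod a \<le> t then real (zero_mult f a) else 0)"
      using fZ by (rule sum.inter_filter)
    finally show ?thesis using that by (auto simp: sum_divide_distrib intro!: sum.cong)
  qed
  have int1: "((\<lambda>t. if t \<in> {cmod a..r} then 1 / t else 0) has_integral ln (r / cmod a)) {0..r}"
    if a: "a \<in> Z" for a
  proof -
    have a': "0 < cmod a" "cmod a \<le> r" using a by (auto simp: Z_def zeros_upto_def)
    have "((\<lambda>t. 1 / t) has_integral (ln r - ln (cmod a))) {cmod a..r}"
      by (rule fundamental_theorem_of_calculus)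
         (use a' in \<open>auto intro!: derivative_eq_intros less_le_trans[OF a'(1)] simp: has_real_derivative_iff_has_vector_derivative[symmetric]\<close>)
    then have "((\<lambda>t. 1 / t) has_integral ln (r / cmod a)) {cmod a..r}" using a' r by (simp add: ln_div)
    then show ?thesis
      using a' by (subst has_integral_restrict) auto
  qed
  have "((\<lambda>t. \<Sum>a\<in>Z. real (zero_mult f a) * (if t \<in> {cmod a..r} then 1 / t else 0)) has_integral
       (\<Sum>a\<in>Z. real (zero_mult f a) * ln (r / cmod a))) {0..r}"
    by (intro has_integral_sum fZ has_integral_mult_right int1)
  then have "((\<lambda>t. (zero_count f t - zero_count f 0) / t) has_integral
       (\<Sum>a\<in>Z. real (zero_mult f a) * ln (r / cmod a))) {0..r}"
    by (rule has_integral_eq[rotated]) (simp add: eq)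
  then show ?thesis unfolding nev_N_zeros_def zc0 Z_def by (simp add: integral_unique)
qed

text \<open>The mean value property of Re \<open>L\<close> gives the mean of log |f| as Re L(0). The
  constant is obtained before \<open>r\<close>: it is the logarithm of the leading
  coefficient.\<close>

lemma Jensen:
  obtains C where "\<And>r. \<lbrakk>r > 0; \<And>z. cmod z = r \<Longrightarrow> f z \<noteq> 0\<rbrakk>
     \<Longrightarrow> circle_mean (\<lambda>z. ln (cmod (f z))) r = nev_N_zeros f r + C"
proof -
  obtain c where c: "c > 0" "\<forall>Z g. finite Z \<longrightarrow> (f 0 = 0 \<longrightarrow> 0 \<in> Z) \<longrightarrow> g holomorphic_on UNIV \<longrightarrow>
     (\<forall>z. f z = (\<Prod>a\<in>Z. (z - a) ^ zero_mult f a) * g z) \<longrightarrow>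
     c = (\<Prod>a\<in>Z - {0}. cmod a ^ zero_mult f a) * cmod (g 0)"
    using leading_coefficient by blast
  have "circle_mean (\<lambda>z. ln (cmod (f z))) r = nev_N_zeros f r + ln c"
    if r: "r > 0" and nz: "\<And>z. cmod z = r \<Longrightarrow> f z \<noteq> 0" for r
  proof -
    obtain e L g where L: "e > r" "L holomorphic_on ball 0 e" "g holomorphic_on UNIV"
    "\<And>z. f z = (\<Prod>a\<in>zeros_upto f r. (z - a) ^ zero_mult f a) * g z" "g 0 \<noteq> 0"
    "\<And>z. cmod z = r \<Longrightarrow> Re (L z) = ln (cmod (f z))"
    "\<And>z. cmod z < r \<Longrightarrow> cmod (f z) \<le> exp (Re (L z))"
    "Re (L 0) = (\<Sum>a\<in>zeros_upto f r. real (zero_mult f a) * ln r) + ln (cmod (g 0))"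
      by (rule Blaschke[OF r nz]; (assumption | rule that))
    define Z where "Z = zeros_upto f r"
    have fZ: "finite Z" unfolding Z_def by (rule finite_zeros_upto)
    \<comment> \<open>This trades the r-dependent \<open>ln (cmod (g 0))\<close> for
      \<open>ln c\<close> minus the logarithms of the moduli of the zeros, which turns each
      \<open>ln r\<close> into \<open>ln (r / cmod a)\<close>.\<close>
    have "c = (\<Prod>a\<in>Z - {0}. cmod a ^ zero_mult f a) * cmod (g 0)"
      unfolding Z_def
    proof (rule c(2)[rule_format, OF finite_zeros_upto _ L(3,4)])
      show "f 0 = 0 \<Longrightarrow> 0 \<in> zeros_upto f r" using r by (simp add: zeros_upto_def)
    qed
    then have "ln c = ln ((\<Prod>a\<in>Z - {0}. cmod a ^ zero_mult f a) * cmod (g 0))" by (rule arg_cong)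
    also have "\<dots> = ln (\<Prod>a\<in>Z - {0}. cmod a ^ zero_mult f a) + ln (cmod (g 0))"
      by (rule ln_mult_pos) (use L(5) in \<open>auto intro!: prod_pos zero_less_power\<close>)
    also have "ln (\<Prod>a\<in>Z - {0}. cmod a ^ zero_mult f a) = (\<Sum>a\<in>Z - {0}. real (zero_mult f a) * ln (cmod a))"
      using fZ by (subst ln_prod) (auto simp: ln_realpow)
    finally have lg: "ln (cmod (g 0)) = ln c - (\<Sum>a\<in>Z - {0}. real (zero_mult f a) * ln (cmod a))" by simp
    have s: "(\<Sum>a\<in>Z. real (zero_mult f a) * ln r)
        = (\<Sum>a\<in>Z - {0}. real (zero_mult f a) * ln r) + real (zero_mult f 0) * ln r"
    proof (cases "f 0 = 0")
      case True
      then have "0 \<in> Z" using r by (simp add: Z_def zeros_upto_def)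
      then show ?thesis using fZ by (simp add: sum.remove[of _ 0])
    next
      case False
      then have "0 \<notin> Z" by (simp add: Z_def zeros_upto_def)
      then show ?thesis using False by (simp add: zero_mult_eq_0_iff)
    qed
    have d: "(\<Sum>a\<in>Z - {0}. real (zero_mult f a) * ln (r / cmod a)) =
       (\<Sum>a\<in>Z - {0}. real (zero_mult f a) * ln r) - (\<Sum>a\<in>Z - {0}. real (zero_mult f a) * ln (cmod a))"
      unfolding sum_subtractf[symmetric]
      by (rule sum.cong) (use r in \<open>auto simp: ln_div algebra_simps\<close>)
    have "circle_mean (\<lambda>z. ln (cmod (f z))) r = circle_mean (\<lambda>z. Re (L z)) r"
      by (rule circle_mean_cong) (use r L(6) in auto)
    also have "\<dots> = Re (L 0)" by (rule circle_mean_Re_holomorphic[OF L(2) r L(1)])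
    finally show ?thesis
      using L(8) lg s d nev_N_zeros_eq[OF r] unfolding Z_def[symmetric] by linarith
  qed
  then show ?thesis using that by blast
qed

lemma nev_N_zeros_nonneg: "r \<ge> 1 \<Longrightarrow> nev_N_zeros f r \<ge> 0"
  by (subst nev_N_zeros_eq)
     (auto intro!: add_nonneg_nonneg sum_nonneg mult_nonneg_nonneg ln_ge_zero simp: zeros_upto_def)

end

section \<open>Local growth of functions of exponential type\<close>

text \<open>Replaces a logarithmic singularity by an inverse square root, which is still integrable
  and has an elementary primitive.\<close>

lemma ln_1_plus_le_sqrt:
  assumes "(x::real) \<ge> 0"
  shows "ln (1 + x) \<le> 2 * sqrt x"
proof -
  have "1 + x \<le> (1 + sqrt x)\<^sup>2" using assms by (simp add: power2_eq_square algebra_simps)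
  then have "ln (1 + x) \<le> ln ((1 + sqrt x)\<^sup>2)" using assms by (subst ln_le_cancel_iff) auto
  also have "\<dots> = 2 * ln (1 + sqrt x)" using assms by (subst ln_realpow) (auto intro: add_pos_nonneg)
  also have "\<dots> \<le> 2 * sqrt x" using assms by (simp add: ln_add_one_self_le_self)
  finally show ?thesis .
qed

text \<open>The signed primitive is continuous across \<open>c\<close>, so the fundamental theorem
  with one exceptional point applies wherever \<open>c\<close> lies, inside the interval or
  not.\<close>

lemma has_integral_inverse_sqrt:
  fixes a b c :: real
  assumes "a \<le> b"
  shows "((\<lambda>x. 1 / sqrt \<bar>x - c\<bar>) has_integral
     (2 * sgn (b - c) * sqrt \<bar>b - c\<bar> - 2 * sgn (a - c) * sqrt \<bar>a - c\<bar>)) {a..b}"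
proof (rule fundamental_theorem_of_calculus_interior_strong[where S = "{c}"])
  have eq: "2 * sgn (x - c) * sqrt \<bar>x - c\<bar> = 2 * sqrt (max 0 (x - c)) - 2 * sqrt (max 0 (c - x))" for x :: real
    by (auto simp: sgn_if max_def)
  show "continuous_on {a..b} (\<lambda>x. 2 * sgn (x - c) * sqrt \<bar>x - c\<bar>)"
    unfolding eq by (intro continuous_intros)
  show "((\<lambda>x. 2 * sgn (x - c) * sqrt \<bar>x - c\<bar>) has_vector_derivative 1 / sqrt \<bar>x - c\<bar>) (at x)"
    if x: "x \<in> {a<..<b} - {c}" for x
  proof (cases "x > c")
    case True
    have d: "((\<lambda>x. 2 * sqrt (x - c)) has_real_derivative 1 / sqrt \<bar>x - c\<bar>) (at x)"
      using True by (auto intro!: derivative_eq_intros simp: field_simps)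
    have e: "\<forall>\<^sub>F y in nhds x. 2 * sqrt (y - c) = 2 * sgn (y - c) * sqrt \<bar>y - c\<bar>"
      using eventually_nhds_in_open[of "{c<..}" x] True by (auto elim!: eventually_mono)
    have "((\<lambda>x. 2 * sgn (x - c) * sqrt \<bar>x - c\<bar>) has_real_derivative 1 / sqrt \<bar>x - c\<bar>) (at x)"
      by (rule DERIV_cong_ev[OF refl e refl, THEN iffD1, OF d])
    then show ?thesis by (simp add: has_real_derivative_iff_has_vector_derivative)
  next
    case False
    then have "x < c" using x by auto
    have d: "((\<lambda>x. - 2 * sqrt (c - x)) has_real_derivative 1 / sqrt \<bar>x - c\<bar>) (at x)"
      using \<open>x < c\<close> by (auto intro!: derivative_eq_intros simp: field_simps)
    have e: "\<forall>\<^sub>F y in nhds x. - 2 * sqrt (c - y) = 2 * sgn (y - c) * sqrt \<bar>y - c\<bar>"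
      using eventually_nhds_in_open[of "{..<c}" x] \<open>x < c\<close> by (auto elim!: eventually_mono)
    have "((\<lambda>x. 2 * sgn (x - c) * sqrt \<bar>x - c\<bar>) has_real_derivative 1 / sqrt \<bar>x - c\<bar>) (at x)"
      by (rule DERIV_cong_ev[OF refl e refl, THEN iffD1, OF d])
    then show ?thesis by (simp add: has_real_derivative_iff_has_vector_derivative)
  qed
qed (use assms in auto)

text \<open>The chord has length 2 |sin(x/2)|. For 0 \<le> u \<le> 2 the cubic Taylor bound gives
  sin u \<ge> u - u^3/6 \<ge> u/3, which more than covers the constant 1/4.\<close>

lemma norm_cis_minus_1_ge:
  assumes "\<bar>x\<bar> \<le> pi"
  shows "cmod (cis x - 1) \<ge> \<bar>x\<bar> / 4"
proof -
  have c: "cmod (cis x - 1) = 2 * \<bar>sin (x / 2)\<bar>"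
  using dist_exp_i_1[of x] by (simp add: cis_conv_exp)
  have main: "y / 4 \<le> 2 * sin (y / 2)" if "0 \<le> y" "y \<le> pi" for y
  proof -
    have "\<bar>sin (y / 2) - y / 2\<bar> \<le> (y / 2) ^ 3 / 6"
      using Maclaurin_sin_bound[of "y / 2" 3] that
      by (simp add: eval_nat_numeral sin_coeff_def divide_simps)
    moreover have "(y/2)^3 \<le> (y/2) * 4"
    proof -
      have "(y/2)\<^sup>2 \<le> 2\<^sup>2" by (rule power_mono) (use that pi_less_4 in auto)
      then have "(y/2) * (y/2)\<^sup>2 \<le> (y/2) * 4" using that by (intro mult_left_mono) auto
      then show ?thesis by (simp add: power3_eq_cube power2_eq_square)
    qed
    ultimately show ?thesis using that by linarith
  qed
  show ?thesis
    unfolding c using main[of x] main[of "-x"] assms by (cases "x \<ge> 0") auto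
qed

lemma continuous_on_ln_one_plus_inverse_dist:
  assumes "cmod a \<noteq> r"
  shows "continuous_on (sphere 0 r) (\<lambda>z. ln (1 + 2 / cmod (z - a)))"
proof (intro continuous_intros ballI)
  fix z :: complex assume "z \<in> sphere 0 r"
  then show "cmod (z - a) \<noteq> 0" using assms by auto
  have "1 + 2 / cmod (z - a) > 0" by (rule add_pos_nonneg) auto
  then show "1 + 2 / cmod (z - a) \<noteq> 0" by simp
qed

text \<open>The bound is uniform in \<open>a\<close>, however close \<open>a\<close> is to the
  circle, because only angular distance is used. The point of the circle on the ray through
  \<open>a\<close> is nearest to \<open>a\<close>, so the triangle inequality gives |z - a| \<ge> r
  |x| / 8, where x is the angle between \<open>z\<close> and \<open>a\<close>. The integrand is then
  at most 8 / sqrt(r |x|), which is integrable.\<close>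

lemma circle_mean_ln_one_plus_inverse_dist:
  assumes r: "r > 0" and a: "cmod a \<noteq> r"
  shows "circle_mean (\<lambda>z. ln (1 + 2 / cmod (z - a))) r \<le> 256 / sqrt r"
proof -
  define \<phi> where "\<phi> = Arg a"
  have \<phi>: "- pi < \<phi>" "\<phi> \<le> pi" unfolding \<phi>_def using Arg_bounded by auto
  have a_eq: "a = cmod a * cis \<phi>" unfolding \<phi>_def by (metis rcis_cmod_Arg rcis_def)
  \<comment> \<open>The angle of \<open>a\<close> is taken in (-pi, pi] but \<theta> in [0, 2 pi];
    the difference of absolute value at most pi is either \<theta> - \<phi> or \<theta> - (\<phi> +
    2 pi). Adding both branches spares a case split in the integral.\<close>
  define b where "b \<theta> = 8 / sqrt r * (1 / sqrt \<bar>\<theta> - \<phi>\<bar> + 1 / sqrt \<bar>\<theta> - (\<phi> + 2 * pi)\<bar>)" for \<theta>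
  define J where "J c = 2 * sgn (2 * pi - c) * sqrt \<bar>2 * pi - c\<bar> - 2 * sgn (0 - c) * sqrt \<bar>0 - c\<bar>" for c
  have aux: "\<bar>2 * sgn y * sqrt \<bar>y\<bar>\<bar> \<le> 8" if "\<bar>y\<bar> \<le> 16" for y :: real
  proof -
    have "sqrt \<bar>y\<bar> \<le> 4" by (rule real_le_lsqrt) (use that in auto)
    then show ?thesis by (cases y "0 :: real" rule: linorder_cases) auto
  qed
  have J: "J c \<le> 16" if "\<bar>c\<bar> \<le> 3 * pi" "\<bar>2 * pi - c\<bar> \<le> 3 * pi" for c
  proof -
    have "\<bar>2 * pi - c\<bar> \<le> 16" "\<bar>0 - c\<bar> \<le> 16" using that pi_less_4 by linarith+
    then show ?thesis unfolding J_def using aux[of "2 * pi - c"] aux[of "0 - c"] by linarith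
  qed
  have intb: "(b has_integral 8 / sqrt r * (J \<phi> + J (\<phi> + 2 * pi))) {0..2*pi}"
  proof -
    have p: "0 \<le> 2 * pi" by simp
    show ?thesis
      unfolding b_def J_def
      by (rule has_integral_mult_right[OF has_integral_add[OF has_integral_inverse_sqrt[OF p]
            has_integral_inverse_sqrt[OF p]]])
  qed
  \<comment> \<open>At these two angles a term of \<open>b\<close> is the default value of 1/0,
    namely 0, and \<open>b\<close> need not dominate. The integrand is overwritten there, which
    leaves its integral unchanged.\<close>
  define S where "S = {\<phi>, \<phi> + 2 * pi}"
  have le: "ln (1 + 2 / cmod (r * cis \<theta> - a)) \<le> b \<theta>" if \<theta>: "\<theta> \<in> {0..2*pi}" "\<theta> \<notin> S" for \<theta>
  proof -
    have *: "ln (1 + 2 / cmod (r * cis \<theta> - a)) \<le> 8 / sqrt r * (1 / sqrt \<bar>x\<bar>)"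
      if x: "\<bar>x\<bar> \<le> pi" "x \<noteq> 0" "cis \<theta> = cis x * cis \<phi>" for x
    proof -
      have "cmod (r * cis \<phi> - a) = \<bar>r - cmod a\<bar>"
      proof -
        have "r * cis \<phi> - a = (r - cmod a) * cis \<phi>" by (subst a_eq) (simp add: algebra_simps)
        then have "cmod (r * cis \<phi> - a) = cmod (of_real (r - cmod a))" by (simp add: norm_mult)
        then show ?thesis by (simp only: norm_of_real)
      qed
      also have "\<dots> \<le> cmod (r * cis \<theta> - a)"
        using norm_triangle_ineq3[of "r * cis \<theta>" a] r by (simp add: norm_mult)
      finally have "cmod (r * cis \<theta> - r * cis \<phi>) \<le> 2 * cmod (r * cis \<theta> - a)"
        using norm_triangle_ineq4[of "r * cis \<theta> - a" "r * cis \<phi> - a"] by simp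
      moreover have "cmod (r * cis \<theta> - r * cis \<phi>) = r * cmod (cis x - 1)"
      proof -
        have "r * cis \<theta> - r * cis \<phi> = r * (cis x - 1) * cis \<phi>" by (simp add: x(3) algebra_simps)
        then show ?thesis using r by (simp add: norm_mult)
      qed
      moreover have "r * cmod (cis x - 1) \<ge> r * (\<bar>x\<bar> / 4)"
        using norm_cis_minus_1_ge[OF x(1)] r by (intro mult_left_mono) auto
      ultimately have d: "cmod (r * cis \<theta> - a) \<ge> r * \<bar>x\<bar> / 8" by simp
      have pos: "r * \<bar>x\<bar> / 8 > 0" using r x(2) by simp
      have "ln (1 + 2 / cmod (r * cis \<theta> - a)) \<le> 2 * sqrt (2 / cmod (r * cis \<theta> - a))"
        by (rule ln_1_plus_le_sqrt) simp
      also have "\<dots> \<le> 2 * sqrt (2 / (r * \<bar>x\<bar> / 8))"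
        using d pos by (intro mult_left_mono real_sqrt_le_mono divide_left_mono mult_pos_pos) auto
      also have "2 / (r * \<bar>x\<bar> / 8) = 16 / (r * \<bar>x\<bar>)" by simp
      also have "2 * sqrt (16 / (r * \<bar>x\<bar>)) = 8 / sqrt r * (1 / sqrt \<bar>x\<bar>)"
        by (simp add: real_sqrt_divide real_sqrt_mult)
      finally show ?thesis .
    qed
    show ?thesis
    proof (cases "\<bar>\<theta> - \<phi>\<bar> \<le> pi")
      case True
      have "ln (1 + 2 / cmod (r * cis \<theta> - a)) \<le> 8 / sqrt r * (1 / sqrt \<bar>\<theta> - \<phi>\<bar>)"
        by (rule *[OF True]) (use that in \<open>auto simp: S_def cis_mult\<close>)
      also have "\<dots> \<le> b \<theta>" unfolding b_def using r by (intro mult_left_mono) auto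
      finally show ?thesis .
    next
      case False
      have "ln (1 + 2 / cmod (r * cis \<theta> - a)) \<le> 8 / sqrt r * (1 / sqrt \<bar>\<theta> - (\<phi> + 2 * pi)\<bar>)"
      proof (rule *)
        show "\<bar>\<theta> - (\<phi> + 2 * pi)\<bar> \<le> pi" using False that \<phi> by auto
        show "cis \<theta> = cis (\<theta> - (\<phi> + 2 * pi)) * cis \<phi>"
          using cis_mult[of "\<theta> - 2 * pi" "2 * pi"] by (simp add: cis_mult)
      qed (use that in \<open>auto simp: S_def\<close>)
      also have "\<dots> \<le> b \<theta>" unfolding b_def using r by (intro mult_left_mono) auto
      finally show ?thesis .
    qed
  qed
  define u where "u \<theta> = ln (1 + 2 / cmod (r * cis \<theta> - a))" for \<theta>
  have cont: "continuous_on {0..2*pi} u"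
    unfolding u_def
    by (rule continuous_on_circle[OF continuous_on_ln_one_plus_inverse_dist[OF a]]) (use r in auto)
  have "(u has_integral integral {0..2*pi} u) {0..2*pi}"
    by (intro integrable_integral integrable_continuous_real cont)
  then have intu: "((\<lambda>\<theta>. if \<theta> \<in> S then b \<theta> else u \<theta>) has_integral integral {0..2*pi} u) {0..2*pi}"
    by (rule has_integral_spike_finite[of S, rotated 2]) (auto simp: S_def)
  have "integral {0..2*pi} u \<le> 8 / sqrt r * (J \<phi> + J (\<phi> + 2 * pi))"
    by (rule has_integral_le[OF intu intb]) (use le in \<open>auto simp: u_def\<close>)
  also have "\<dots> \<le> 8 / sqrt r * (16 + 16)"
    using \<phi> r by (intro mult_left_mono add_mono J) auto
  finally have "integral {0..2*pi} u \<le> 256 / sqrt r" by simp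
  moreover have "256 / sqrt r \<ge> 0" using r by simp
  ultimately have "integral {0..2*pi} u \<le> 2 * pi * (256 / sqrt r)"
    using pi_gt3 mult_right_mono[of 1 "2 * pi" "256 / sqrt r"] by linarith
  then show ?thesis unfolding circle_mean_def u_def by (simp add: field_simps)
qed

text \<open>The map H / (2B - H) sends the half-plane Re < B into the unit disc and fixes 0.
  Schwarz's lemma bounds it by 1/2 on the half disc, and |H| \<le> (2B + |H|)/2 gives the
  claim.\<close>

lemma Borel_Caratheodory:
  assumes H: "H holomorphic_on ball 0 R" "H 0 = 0" and R: "R > 0"
    and B: "\<And>z. cmod z < R \<Longrightarrow> Re (H z) < B" and z: "cmod z \<le> R / 2"
  shows "cmod (H z) \<le> 2 * B"
proof -
  have B0: "B > 0" using B[of 0] H R by simp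
  define \<psi> where "\<psi> w = H (R * w) / (2 * B - H (R * w))" for w :: complex
  have Rw: "cmod (of_real R * w) < R" if "cmod w < 1" for w
    using that R mult_strict_left_mono[of "cmod w" 1 R] by (simp add: norm_mult)
  have nz: "2 * B - H (R * w) \<noteq> 0" if "cmod w < 1" for w :: complex
    using B[OF Rw[OF that]] B0 by (auto simp: complex_eq_iff)
  have lt: "cmod (H (R * w)) < cmod (2 * B - H (R * w))" if "cmod w < 1" for w :: complex
  proof (rule power2_less_imp_less)
    have "B * Re (H (R * w)) < B * B" using B[OF Rw[OF that]] B0 by simp
    then show "(cmod (H (R * w)))\<^sup>2 < (cmod (2 * B - H (R * w)))\<^sup>2"
      unfolding cmod_power2 by (simp add: power2_eq_square algebra_simps)
  qed simp
  have "\<psi> holomorphic_on ball 0 1"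
    unfolding \<psi>_def
    by (intro holomorphic_intros holomorphic_on_compose_gen[OF _ H(1), unfolded o_def])
       (use Rw nz in auto)
  moreover have "\<psi> 0 = 0" by (simp add: \<psi>_def H)
  moreover have "cmod (\<psi> w) < 1" if "cmod w < 1" for w
    using lt[OF that] nz[OF that] by (simp add: \<psi>_def norm_divide)
  moreover have zR: "cmod (z / R) < 1" using z R by (simp add: norm_divide field_simps)
  ultimately have "cmod (\<psi> (z / R)) \<le> cmod (z / R)" by (rule Schwarz_Lemma(1))
  also have "\<dots> \<le> 1 / 2" using z R by (simp add: norm_divide field_simps)
  finally have "cmod (H z) \<le> 1 / 2 * cmod (2 * B - H z)"
    using nz[OF zR] R by (simp add: \<psi>_def norm_divide field_simps)
  also have "\<dots> \<le> 1 / 2 * (2 * B + cmod (H z))"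
    using norm_triangle_ineq4[of "2 * of_real B" "H z"] B0 by (simp add: norm_mult)
  finally show ?thesis by simp
qed

text \<open>This stands in for the lemmas on logarithmic derivatives and on difference quotients.
  Write \<open>f\<close> as a polynomial with the zeros up to \<open>R\<close> times
  \<open>g\<close>. A logarithm of the zero-free \<open>g\<close> is O(R) on a disc of radius
  comparable to \<open>R\<close>, so it changes by O(1) over distance 2, while each linear factor
  grows by at most 1 + 2/|z - a|. Distance 2 leaves one unit for the shift and one for Cauchy's
  inequality.\<close>

lemma (in nonzero_entire) local_growth:
  assumes C: "\<And>z. cmod (f z) \<le> C * exp (b * cmod z)" and b: "b \<ge> 0"
  shows "\<exists>A\<ge>0. \<forall>r\<ge>2. \<exists>R\<ge>r. real (\<Sum>a\<in>zeros_upto f R. zero_mult f a) \<le> A * r \<and>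
    (\<forall>z w. cmod z = r \<longrightarrow> cmod (w - z) \<le> 2 \<longrightarrow> f z \<noteq> 0 \<longrightarrow>
      cmod (f w) \<le> exp (A + (\<Sum>a\<in>zeros_upto f R. zero_mult f a * ln (1 + 2 / cmod (z - a)))) * cmod (f z))"
proof -
  obtain c where c: "c > 0" "\<forall>Z g. finite Z \<longrightarrow> (f 0 = 0 \<longrightarrow> 0 \<in> Z) \<longrightarrow> g holomorphic_on UNIV \<longrightarrow>
     (\<forall>z. f z = (\<Prod>a\<in>Z. (z - a) ^ zero_mult f a) * g z) \<longrightarrow>
     c = (\<Prod>a\<in>Z - {0}. cmod a ^ zero_mult f a) * cmod (g 0)"
    using leading_coefficient by blast
  obtain w0 where w0: "f w0 \<noteq> 0" using nonzero by blast
  have C0: "C > 0"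
  proof (rule ccontr)
    assume "\<not> C > 0"
    then have "C * exp (b * cmod w0) \<le> 0" by (intro mult_nonpos_nonneg) auto
    then show False using C[of w0] w0 by (auto dest: order_trans)
  qed
  define D where "D = \<bar>ln (C / c)\<bar> + 1"
  \<comment> \<open>With \<open>R = 8 * r\<close> and \<open>B = D + 3 * b * R\<close>, the constant
    has to dominate both \<open>2 * B / r\<close>, which bounds the number of zeros, and
    \<open>16 * B / R\<close>, which bounds the change of log \<open>g\<close>.\<close>
  define A where "A = 2 * D + 48 * b + 16 * D"
  show ?thesis
  proof (rule exI[of _ A], intro conjI allI impI)
    show "A \<ge> 0" using b by (simp add: A_def D_def)
  next
    fix r :: real assume r: "r \<ge> 2"
    \<comment> \<open>Since r \<ge> 2, all points within 2 of the circle have modulus at most R/4.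
      \<open>H\<close> is bounded up to R/2, which leaves R/4 for Cauchy's inequality.\<close>
    define R where "R = 8 * r"
    define Z where "Z = zeros_upto f R"
    define n where "n = (\<Sum>a\<in>Z. zero_mult f a)"
    have R: "R \<ge> 16" "R \<ge> r" "r + 2 \<le> R / 4" using r by (auto simp: R_def)
    have fZ: "finite Z" unfolding Z_def by (rule finite_zeros_upto)
    obtain g where g: "g holomorphic_on UNIV"
      "\<And>z. f z = (\<Prod>a\<in>zeros_upto f R. (z - a) ^ zero_mult f a) * g z"
      "\<And>z. cmod z \<le> R \<Longrightarrow> g z \<noteq> 0"
      by (rule zeros_upto_factor[of R]) (rule that)
    note g = g[folded Z_def]
    have c_eq: "c = (\<Prod>a\<in>Z - {0}. cmod a ^ zero_mult f a) * cmod (g 0)"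
      by (rule c(2)[rule_format, OF fZ _ g(1,2)]) (use R in \<open>auto simp: Z_def zeros_upto_def\<close>)
    have g0: "cmod (g 0) > 0" using g(3)[of 0] R by simp
    have "(\<Prod>a\<in>Z - {0}. cmod a ^ zero_mult f a) \<le> (\<Prod>a\<in>Z - {0}. R ^ zero_mult f a)"
      by (intro prod_mono) (auto simp: Z_def zeros_upto_def intro!: power_mono)
    also have "\<dots> \<le> (\<Prod>a\<in>Z. R ^ zero_mult f a)"
      by (rule prod_mono2) (use fZ R in \<open>auto intro: one_le_power\<close>)
    also have "\<dots> = R ^ n" by (simp add: n_def power_sum)
    finally have c_le: "c \<le> R ^ n * cmod (g 0)"
      unfolding c_eq using g0 by (intro mult_right_mono) auto
    \<comment> \<open>On radius 3R every zero is at distance at least 2R, whereas its modulus is at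
      most R. The quotient of these bounds is the surplus 2^n exploited in
      \<open>ratio\<close>.\<close>
    have sph: "cmod (g z) \<le> C * exp (3 * b * R) / (2 * R) ^ n" if z: "cmod z = 3 * R" for z
    proof -
      have "(2 * R) ^ n = (\<Prod>a\<in>Z. (2 * R) ^ zero_mult f a)" by (simp add: n_def power_sum)
      also have "\<dots> \<le> (\<Prod>a\<in>Z. cmod (z - a) ^ zero_mult f a)"
      proof (intro prod_mono conjI power_mono)
        fix a assume "a \<in> Z"
        then show "2 * R \<le> cmod (z - a)"
          using norm_triangle_ineq2[of z a] z by (simp add: Z_def zeros_upto_def)
      qed (use R in auto)
      finally have "(2 * R) ^ n * cmod (g z) \<le> cmod (f z)"
        unfolding g(2)[of z] norm_mult prod_norm[symmetric] norm_power by (intro mult_right_mono) auto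
      also have "\<dots> \<le> C * exp (3 * b * R)" using C[of z] z by (simp add: mult_ac)
      finally show ?thesis using R by (simp add: field_simps)
    qed
    have gb: "cmod (g z) \<le> C * exp (3 * b * R) / (2 * R) ^ n" if "cmod z \<le> 3 * R" for z
      by (rule maximum_modulus_frontier[of g "cball 0 (3 * R)"])
         (use g(1) sph that R in \<open>auto intro: holomorphic_on_subset holomorphic_on_imp_continuous_on\<close>)
    define B where "B = D + 3 * b * R"
    \<comment> \<open>One inequality serves twice: at z = 0 the surplus \<open>n * ln 2\<close>
      bounds the number of zeros, and without the surplus it is the upper bound of Re
      \<open>H\<close> for Borel-Caratheodory.\<close>
    have ratio: "ln (cmod (g z)) - ln (cmod (g 0)) + n * ln 2 < B" if z: "cmod z \<le> R" for z
    proof -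
      have gz: "cmod (g z) > 0" using g(3)[OF z] by simp
      have "cmod (g z) * (2 * R) ^ n \<le> C * exp (3 * b * R)"
        using gb[of z] z R by (simp add: field_simps)
      then have "cmod (g z) * (2 * R) ^ n * c \<le> C * exp (3 * b * R) * (R ^ n * cmod (g 0))"
        by (rule mult_mono[OF _ c_le]) (use C0 c(1) in auto)
      then have "(cmod (g z) * 2 ^ n * c) * R ^ n \<le> (C * exp (3 * b * R) * cmod (g 0)) * R ^ n"
        by (simp add: power_mult_distrib mult_ac)
      then have "cmod (g z) * 2 ^ n * c \<le> C * exp (3 * b * R) * cmod (g 0)"
        using R by (simp add: zero_less_power)
      then have "ln (cmod (g z) * 2 ^ n * c) \<le> ln (C * exp (3 * b * R) * cmod (g 0))"
        using gz c(1) by (intro ln_mono) auto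
      then have "ln (cmod (g z)) + n * ln 2 + ln c \<le> ln C + 3 * b * R + ln (cmod (g 0))"
        using gz c(1) C0 g0 by (simp add: ln_mult_pos ln_realpow)
      then show ?thesis using c(1) C0 unfolding B_def D_def by (simp add: ln_div)
    qed
    have "D \<ge> 1" "3 * b * R \<ge> 0" using b R by (auto simp: D_def)
    then have B0: "B > 0" unfolding B_def by linarith
    have n_le: "real n \<le> 2 * B"
    proof -
      have "n * ln 2 < B" using ratio[of 0] R by simp
      moreover have "real n * (1 / 2) \<le> n * ln 2" using ln2_ge_two_thirds by (intro mult_left_mono) auto
      ultimately show ?thesis by simp
    qed
    have gnz: "g z \<noteq> 0" if "z \<in> cball 0 R" for z using g(3)[of z] that by simp
    have Rpos: "R > 0" using R by simp
    obtain L e where L: "e > R" "L holomorphic_on ball 0 e" "\<And>z. z \<in> ball 0 e \<Longrightarrow> g z = exp (L z)"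
      by (rule exists_log_on_larger_ball[OF g(1) gnz Rpos]; (assumption | rule that))
    define H where "H z = L z - L 0" for z
    have Hh: "H holomorphic_on ball 0 R"
      unfolding H_def by (intro holomorphic_intros holomorphic_on_subset[OF L(2)]) (use L(1) in auto)
    have H_le: "cmod (H z) \<le> 2 * B" if "cmod z \<le> R / 2" for z
    proof (rule Borel_Caratheodory[OF Hh _ _ _ that])
      fix z assume z: "cmod z < R"
      have "ln (cmod (g z)) = Re (L z)" "ln (cmod (g 0)) = Re (L 0)"
        using L(3)[of z] L(3)[of 0] z L(1) R by auto
      moreover have "real n * ln 2 \<ge> 0" by simp
      ultimately show "Re (H z) < B" using ratio[of z] z unfolding H_def minus_complex.sel by linarith
    qed (use R in \<open>auto simp: H_def\<close>)
    have dH: "cmod (deriv H z) \<le> 8 * B / R" if "cmod z \<le> R / 4" for z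
    proof -
      have sub: "cball z (R / 4) \<subseteq> cball 0 (R / 2)"
      proof
        fix x assume "x \<in> cball z (R / 4)"
        then show "x \<in> cball 0 (R / 2)"
          using that norm_triangle_ineq2[of x z] by (simp add: dist_norm norm_minus_commute)
      qed
      have "cball 0 (R / 2) \<subseteq> ball 0 R" using R by auto
      then have hb: "H holomorphic_on cball z (R / 4)"
        using Hh sub by (meson holomorphic_on_subset order_trans)
      have "cmod ((deriv ^^ 1) H z) \<le> fact 1 * (2 * B) / (R / 4) ^ 1"
      proof (rule Cauchy_inequality)
        fix x assume "cmod (z - x) = R / 4"
        then have "x \<in> cball 0 (R / 2)" using sub by (auto simp: dist_norm)
        then show "cmod (H x) \<le> 2 * B" using H_le by simp
      qed (use hb R in \<open>auto intro: holomorphic_on_subset holomorphic_on_imp_continuous_on\<close>)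
      then show ?thesis by simp
    qed
    have diff: "cmod (H w - H z) \<le> 8 * B / R * cmod (w - z)" if "cmod w \<le> R / 4" "cmod z \<le> R / 4" for w z
    proof (rule field_differentiable_bound[where S = "cball 0 (R / 4)" and f' = "deriv H"])
      fix x :: complex assume "x \<in> cball 0 (R / 4)"
      then show "(H has_field_derivative deriv H x) (at x within cball 0 (R / 4))"
        using R by (intro holomorphic_derivI[OF Hh]) auto
    qed (use that dH in auto)
    have BA: "16 * B / R \<le> A"
    proof -
      have "16 * D / R \<le> 16 * D / 1" using R by (intro divide_left_mono) (auto simp: D_def)
      then have "16 * D / R + 48 * b \<le> A" by (simp add: A_def D_def)
      moreover have "16 * B / R = 16 * D / R + 48 * b" using R by (simp add: B_def field_simps)
      ultimately show ?thesis by simp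
    qed
    show "\<exists>R\<ge>r. real (\<Sum>a\<in>zeros_upto f R. zero_mult f a) \<le> A * r \<and>
      (\<forall>z w. cmod z = r \<longrightarrow> cmod (w - z) \<le> 2 \<longrightarrow> f z \<noteq> 0 \<longrightarrow>
      cmod (f w) \<le> exp (A + (\<Sum>a\<in>zeros_upto f R. zero_mult f a * ln (1 + 2 / cmod (z - a)))) * cmod (f z))"
    proof (intro exI[of _ R] conjI allI impI; (fold Z_def)?; (fold n_def)?)
      show "R \<ge> r" by (rule R)
      have "2 * B = 2 * D + 48 * b * r" by (simp add: B_def R_def)
      also have "\<dots> \<le> (2 * D) * r + (48 * b) * r + (16 * D) * r"
      proof -
        have "(2 * D) * 1 \<le> (2 * D) * r" "0 \<le> (16 * D) * r"
          using r \<open>D \<ge> 1\<close> by (auto intro!: mult_left_mono mult_nonneg_nonneg)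
        then show ?thesis by linarith
      qed
      also have "\<dots> = A * r" by (simp add: A_def algebra_simps)
      finally show "real n \<le> A * r" using n_le by linarith
    next
      fix z w assume z: "cmod z = r" and w: "cmod (w - z) \<le> 2" and fz: "f z \<noteq> 0"
      have wR: "cmod w \<le> R / 4" using norm_triangle_ineq2[of w z] z w R by linarith
      have zR: "cmod z \<le> R / 4" using z R by simp
      have zZ: "cmod (z - a) > 0" if "a \<in> Z" for a using that fz by (auto simp: Z_def zeros_upto_def)
      have "cmod (g w) = cmod (g z) * exp (Re (H w - H z))"
      proof -
        have "g w = exp (L w)" "g z = exp (L z)" using L wR zR R by auto
        then show ?thesis by (simp add: H_def exp_diff)
      qed
      also have "Re (H w - H z) \<le> cmod (H w - H z)" by (rule complex_Re_le_cmod)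
      also have "\<dots> \<le> 8 * B / R * cmod (w - z)" by (rule diff[OF wR zR])
      also have "\<dots> \<le> 8 * B / R * 2" by (rule mult_left_mono[OF w]) (use B0 R in auto)
      also have "\<dots> \<le> A" using BA by simp
      finally have gw: "cmod (g w) \<le> cmod (g z) * exp A" by (simp add: mult_left_mono)
      have "(\<Prod>a\<in>Z. cmod (w - a) ^ zero_mult f a)
          \<le> (\<Prod>a\<in>Z. exp (zero_mult f a * ln (1 + 2 / cmod (z - a))) * cmod (z - a) ^ zero_mult f a)"
      proof (intro prod_mono conjI)
        fix a assume a: "a \<in> Z"
        have "cmod (w - a) \<le> cmod (z - a) + 2"
          using norm_triangle_ineq[of "z - a" "w - z"] w by simp
        also have "\<dots> = (1 + 2 / cmod (z - a)) * cmod (z - a)" using zZ[OF a] by (simp add: field_simps)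
        finally have "cmod (w - a) ^ zero_mult f a \<le> ((1 + 2 / cmod (z - a)) * cmod (z - a)) ^ zero_mult f a"
          by (rule power_mono) simp
        also have "\<dots> = exp (zero_mult f a * ln (1 + 2 / cmod (z - a))) * cmod (z - a) ^ zero_mult f a"
          using zZ[OF a] by (simp add: power_mult_distrib exp_of_nat_mult add_pos_pos)
        finally show "cmod (w - a) ^ zero_mult f a \<le> \<dots>" .
      qed simp
      also have "\<dots> = exp (\<Sum>a\<in>Z. zero_mult f a * ln (1 + 2 / cmod (z - a))) * (\<Prod>a\<in>Z. cmod (z - a) ^ zero_mult f a)"
        using fZ by (simp add: prod.distrib exp_sum)
      finally have "cmod (f w) \<le> (exp (\<Sum>a\<in>Z. zero_mult f a * ln (1 + 2 / cmod (z - a))) * (\<Prod>a\<in>Z. cmod (z - a) ^ zero_mult f a)) * (cmod (g z) * exp A)"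
        unfolding g(2)[of w] norm_mult prod_norm[symmetric] norm_power
        by (rule mult_mono[OF _ gw]) (auto intro!: mult_nonneg_nonneg prod_nonneg)
      also have "\<dots> = exp (A + (\<Sum>a\<in>Z. zero_mult f a * ln (1 + 2 / cmod (z - a)))) * cmod (f z)"
        unfolding g(2)[of z] norm_mult prod_norm[symmetric] norm_power by (simp add: exp_add mult_ac)
      finally show "cmod (f w) \<le> \<dots>" .
    qed
  qed
qed

section \<open>Growth of the solution\<close>

text \<open>An exponential bound with arbitrarily small rate makes \<open>q\<close> cost only
  \<epsilon> r in logarithms, to be absorbed by linear growth. In the induction half of the rate
  pays for the extra factor z.\<close>

lemma poly_le_exp:
  fixes q :: "complex poly"
  assumes "\<epsilon> > 0"
  shows "\<exists>K\<ge>1. \<forall>z. cmod (poly q z) \<le> K * exp (\<epsilon> * cmod z)"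
  using assms
proof (induction q arbitrary: \<epsilon>)
  case 0
  then show ?case by (intro exI[of _ 1]) auto
next
  case (pCons a p)
  from pCons.IH[of "\<epsilon> / 2"] pCons.prems obtain K where K: "K \<ge> 1"
    "\<And>z. cmod (poly p z) \<le> K * exp (\<epsilon> / 2 * cmod z)" by auto
  have "cmod (poly (pCons a p) z) \<le> (cmod a + K * 2 / \<epsilon> + 1) * exp (\<epsilon> * cmod z)" for z
  proof -
    have "\<epsilon> / 2 * cmod z \<le> exp (\<epsilon> / 2 * cmod z)"
      using exp_ge_add_one_self[of "\<epsilon> / 2 * cmod z"] by linarith
    then have "cmod z \<le> 2 / \<epsilon> * exp (\<epsilon> / 2 * cmod z)" using pCons.prems by (simp add: field_simps)
    then have "cmod z * cmod (poly p z) \<le> (2 / \<epsilon> * exp (\<epsilon> / 2 * cmod z)) * (K * exp (\<epsilon> / 2 * cmod z))"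
      by (rule mult_mono[OF _ K(2)]) (use pCons.prems in auto)
    also have "\<dots> = K * 2 / \<epsilon> * (exp (\<epsilon> / 2 * cmod z) * exp (\<epsilon> / 2 * cmod z))" by simp
    also have "exp (\<epsilon> / 2 * cmod z) * exp (\<epsilon> / 2 * cmod z) = exp (\<epsilon> * cmod z)"
      unfolding exp_add[symmetric] by (simp add: field_simps)
    finally have 1: "cmod z * cmod (poly p z) \<le> K * 2 / \<epsilon> * exp (\<epsilon> * cmod z)" .
    have 2: "(cmod a + 1) * 1 \<le> (cmod a + 1) * exp (\<epsilon> * cmod z)"
      using pCons.prems by (intro mult_left_mono) auto
    have "cmod (poly (pCons a p) z) \<le> cmod a + cmod z * cmod (poly p z)"
      by (simp add: norm_mult[symmetric] norm_triangle_ineq)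
    also have "\<dots> \<le> (cmod a + 1) * exp (\<epsilon> * cmod z) + K * 2 / \<epsilon> * exp (\<epsilon> * cmod z)"
      using 1 2 by simp
    finally show ?thesis by (simp add: algebra_simps)
  qed
  moreover have "cmod a + K * 2 / \<epsilon> + 1 \<ge> 1" using K pCons.prems by simp
  ultimately show ?case by blast
qed

section \<open>Choosing radii off exceptional sets\<close>

lemma exists_outside_countable:
  fixes B :: "real set"
  assumes "countable B"
  shows "\<exists>r. s < r \<and> r < s + 1 \<and> r \<notin> B"
proof (rule ccontr)
  assume "\<not> ?thesis"
  then have "{s<..<s+1} \<subseteq> B" by auto
  then show False using assms countable_subset uncountable_open_interval[of s "s + 1"] by auto
qed

text \<open>Otherwise the exceptional set contains a half-line up to a null set, and the integral of
  1/t over it diverges.\<close>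

lemma exists_outside_finite_log_measure:
  assumes E: "finite_log_measure E" and B: "countable B"
  shows "\<exists>r\<ge>R. r \<notin> E \<and> r \<notin> B"
proof (rule ccontr)
  assume no: "\<not> ?thesis"
  define a where "a = max R 1"
  have a: "a \<ge> 1" "a \<ge> R" by (auto simp: a_def)
  have Em: "E \<in> sets lborel" using E by (simp add: finite_log_measure_def)
  define I where "I = (\<integral>\<^sup>+ t. indicator E t / ennreal t \<partial>lborel)"
  have I: "I < \<infinity>" using E by (simp add: finite_log_measure_def I_def)
  have Bn: "B \<in> null_sets lborel" using B by (rule countable_imp_null_set_lborel)
  have "ennreal (ln x - ln a) \<le> I" if x: "x \<ge> a" for x
  proof -
    have "(\<integral>\<^sup>+ t. ennreal (1 / t) * indicator {a..x} t \<partial>lborel) = ennreal (ln x - ln a)"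
      by (rule nn_integral_FTC_Icc) (use a x in \<open>auto intro!: derivative_eq_intros\<close>)
    moreover have "(\<integral>\<^sup>+ t. ennreal (1 / t) * indicator {a..x} t \<partial>lborel) \<le> I"
      unfolding I_def
    proof (rule nn_integral_mono_AE)
      show "AE t in lborel. ennreal (1 / t) * indicator {a..x} t \<le> indicator E t / ennreal t"
        using AE_not_in[OF Bn]
      proof eventually_elim
        case (elim t)
        show ?case
        proof (cases "t \<in> {a..x}")
          case True
          then have "t \<ge> R" using a by auto
          then have "t \<in> E" using no elim by blast
          then show ?thesis using True a by (simp add: divide_ennreal[symmetric])
        qed simp
      qed
    qed
    ultimately show ?thesis by simp
  qed
  \<comment> \<open>This endpoint makes the logarithmic length exactly one more than the supposed
    total \<open>I\<close>.\<close>
  from this[of "a * exp (enn2real I + 1)"] a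
  have "ennreal (enn2real I + 1) \<le> I" by (simp add: ln_mult)
  also have "I = ennreal (enn2real I)" using I by (simp add: less_top)
  finally show False by (simp add: ennreal_le_iff)
qed

text \<open>The ray points in the direction of the conjugate of \<alpha>1, where the first exponent
  is real and as large as possible. As |\<alpha>2| \<le> |\<alpha>1| and \<alpha>2 differs from
  \<alpha>1, the second exponent has strictly smaller real part there.\<close>

lemma exponential_sum_lower_aux:
  fixes p1 p2 \<alpha>1 \<alpha>2 :: complex
  assumes "p1 \<noteq> 0" "\<alpha>1 \<noteq> 0" "\<alpha>1 \<noteq> \<alpha>2" "cmod \<alpha>2 \<le> cmod \<alpha>1"
  shows "\<exists>\<delta>>0. \<exists>\<kappa>>0. \<exists>u r0. cmod u = 1 \<and>
    (\<forall>r\<ge>r0. \<kappa> * exp (\<delta> * r) \<le> cmod (p1 * exp (\<alpha>1 * (of_real r * u)) + p2 * exp (\<alpha>2 * (of_real r * u))))"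
proof -
  define \<delta> where "\<delta> = cmod \<alpha>1"
  define u where "u = cnj \<alpha>1 / \<delta>"
  have \<delta>: "\<delta> > 0" using assms by (simp add: \<delta>_def)
  have u: "cmod u = 1" using \<delta> by (simp add: u_def norm_divide \<delta>_def)
  have \<alpha>1u: "\<alpha>1 * u = of_real \<delta>"
    using \<delta> complex_norm_square[of \<alpha>1] by (simp add: u_def \<delta>_def[symmetric] power2_eq_square field_simps)
  define \<beta> where "\<beta> = Re (\<alpha>2 * u)"
  have "\<beta> < \<delta>"
  proof (rule ccontr)
    assume "\<not> \<beta> < \<delta>"
    moreover have le: "cmod (\<alpha>2 * u) \<le> \<delta>" using assms(4) u by (simp add: norm_mult \<delta>_def)
    moreover have "\<beta> \<le> cmod (\<alpha>2 * u)" unfolding \<beta>_def by (rule complex_Re_le_cmod)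
    ultimately have b: "\<beta> = \<delta>" "cmod (\<alpha>2 * u) = \<delta>" by auto
    then have "(Im (\<alpha>2 * u))\<^sup>2 = 0" using cmod_power2[of "\<alpha>2 * u"] unfolding \<beta>_def by simp
    then have "\<alpha>2 * u = of_real \<delta>" using b(1) by (simp add: complex_eq_iff \<beta>_def)
    then have "\<alpha>2 * u = \<alpha>1 * u" using \<alpha>1u by simp
    then show False using u assms(3) by auto
  qed
  \<comment> \<open>From here on the second term is at most half of the first, by x \<le> exp x with
    x = (\<delta> - \<beta>) r.\<close>
  define r0 where "r0 = 2 * cmod p2 / (cmod p1 * (\<delta> - \<beta>))"
  have "cmod p1 / 2 * exp (\<delta> * r) \<le> cmod (p1 * exp (\<alpha>1 * (of_real r * u)) + p2 * exp (\<alpha>2 * (of_real r * u)))"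
    if r: "r \<ge> r0" for r
  proof -
    have n1: "cmod (exp (\<alpha>1 * (of_real r * u))) = exp (\<delta> * r)"
    proof -
      have "\<alpha>1 * (of_real r * u) = of_real (\<delta> * r)" using \<alpha>1u by (simp add: mult_ac)
      then show ?thesis by (simp only: norm_exp_eq_Re Re_complex_of_real)
    qed
    have n2: "cmod (exp (\<alpha>2 * (of_real r * u))) = exp (\<beta> * r)"
    proof -
      have "\<alpha>2 * (of_real r * u) = of_real r * (\<alpha>2 * u)" by (simp add: mult_ac)
      then show ?thesis by (simp only: norm_exp_eq_Re \<beta>_def) (simp add: mult.commute)
    qed
    have "2 * cmod p2 \<le> cmod p1 * ((\<delta> - \<beta>) * r)"
      using r \<open>\<beta> < \<delta>\<close> assms(1) by (simp add: r0_def field_simps)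
    also have "\<dots> \<le> cmod p1 * exp ((\<delta> - \<beta>) * r)"
    proof -
      have "(\<delta> - \<beta>) * r \<le> exp ((\<delta> - \<beta>) * r)"
        using exp_ge_add_one_self[of "(\<delta> - \<beta>) * r"] by linarith
      then show ?thesis by (intro mult_left_mono) auto
    qed
    finally have "2 * cmod p2 * exp (\<beta> * r) \<le> cmod p1 * exp ((\<delta> - \<beta>) * r) * exp (\<beta> * r)"
      by (intro mult_right_mono) auto
    also have "\<dots> = cmod p1 * exp (\<delta> * r)" by (simp add: mult.assoc exp_add[symmetric] algebra_simps)
    finally have "cmod p1 / 2 * exp (\<delta> * r) \<le> cmod p1 * exp (\<delta> * r) - cmod p2 * exp (\<beta> * r)" by simp
    also have "\<dots> \<le> cmod (p1 * exp (\<alpha>1 * (of_real r * u)) + p2 * exp (\<alpha>2 * (of_real r * u)))"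
      using norm_diff_ineq[of "p1 * exp (\<alpha>1 * (of_real r * u))" "p2 * exp (\<alpha>2 * (of_real r * u))"]
      by (simp only: norm_mult n1 n2)
    finally show ?thesis .
  qed
  moreover have "cmod p1 / 2 > 0" using assms by simp
  ultimately show ?thesis using \<delta> u by blast
qed

lemma exponential_sum_lower:
  fixes p1 p2 \<alpha>1 \<alpha>2 :: complex
  assumes "p1 \<noteq> 0" "p2 \<noteq> 0" "\<alpha>1 \<noteq> 0" "\<alpha>2 \<noteq> 0" "\<alpha>1 \<noteq> \<alpha>2"
  shows "\<exists>\<delta>>0. \<exists>\<kappa>>0. \<exists>u r0. cmod u = 1 \<and>
    (\<forall>r\<ge>r0. \<kappa> * exp (\<delta> * r) \<le> cmod (p1 * exp (\<alpha>1 * (of_real r * u)) + p2 * exp (\<alpha>2 * (of_real r * u))))"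
proof (cases "cmod \<alpha>2 \<le> cmod \<alpha>1")
  case True
  then show ?thesis using exponential_sum_lower_aux[of p1 \<alpha>1 \<alpha>2 p2] assms by blast
next
  case False
  then show ?thesis using exponential_sum_lower_aux[of p2 \<alpha>2 \<alpha>1 p1] assms
    unfolding add.commute[of "p1 * _"] by simp
qed

lemma nev_T_nonneg: "nev_T f r \<ge> 0"
proof -
  have "integral {0..2*pi} (\<lambda>\<theta>. max 0 (ln (cmod (f (complex_of_real r * cis \<theta>))))) \<ge> 0"
    \<comment> \<open>\<open>f\<close> is arbitrary here; a non-integrable integrand has integral 0
      by convention.\<close>
    by (cases "(\<lambda>\<theta>. max 0 (ln (cmod (f (complex_of_real r * cis \<theta>))))) integrable_on {0..2*pi}")
       (auto intro: integral_nonneg simp: not_integrable_integral)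
  then show ?thesis by (simp add: nev_T_def)
qed

lemma nev_T_le_exp_powr:
  assumes "hyper_order f < 1"
  shows "\<exists>\<sigma> R. 0 < \<sigma> \<and> \<sigma> < 1 \<and> (\<forall>r\<ge>R. nev_T f r \<le> exp (r powr \<sigma>))"
proof -
  obtain x where x: "hyper_order f < x" "x < 1" using dense[OF assms] by blast
  \<comment> \<open>The maximum with 1/2 makes the exponent a positive real.\<close>
  have "max x (ereal (1/2)) < 1" using x by simp
  then obtain \<sigma> where \<sigma>: "max x (ereal (1/2)) = ereal \<sigma>" "0 < \<sigma>" "\<sigma> < 1"
    by (cases "max x (ereal (1/2))") (auto simp: max_def split: if_splits)
  have "hyper_order f < ereal \<sigma>" unfolding \<sigma>(1)[symmetric] using x(1) by (simp add: less_max_iff_disj)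
  then have "\<forall>\<^sub>F r in at_top. ereal (ln (ln (nev_T f r)) / ln r) < ereal \<sigma>"
    unfolding hyper_order_def by (rule Limsup_lessD)
  then have "\<forall>\<^sub>F r in at_top. nev_T f r \<le> exp (r powr \<sigma>)"
    using eventually_gt_at_top[of 1]
  proof eventually_elim
    case (elim r)
    show ?case
    \<comment> \<open>The iterated logarithm is informative only for T > 1; below that the claim is
      trivial as exp is at least 1 here.\<close>
    proof (cases "nev_T f r \<le> 1")
      case True
      moreover have "1 \<le> exp (r powr \<sigma>)" by simp
      ultimately show ?thesis by linarith
    next
      case False
      then have T: "nev_T f r > 1" and y: "ln (nev_T f r) > 0" by auto
      have "ln (ln (nev_T f r)) < \<sigma> * ln r" using elim by (simp add: divide_less_eq)
      then have "ln (nev_T f r) < exp (\<sigma> * ln r)" using y by (metis exp_less_cancel_iff exp_ln)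
      also have "\<dots> = r powr \<sigma>" using elim by (simp add: powr_def)
      finally have "exp (ln (nev_T f r)) \<le> exp (r powr \<sigma>)" by simp
      then show ?thesis using T by simp
    qed
  qed
  then show ?thesis using \<sigma> unfolding eventually_at_top_linorder by blast
qed

text \<open>Here \<sigma> < 1 is decisive: the sublinear power is eventually at most y/8, about n/4,
  so the left side is of order exp(n/4). One more factor exp(n/4) absorbs the constants, and
  exp(n/2) \<le> 2^n.\<close>

lemma double_exp_beats_exp_powr:
  assumes \<sigma>: "0 < \<sigma>" "\<sigma> < 1" and s: "s \<ge> 0"
  shows "\<exists>N. \<forall>n\<ge>N. 3 * exp ((2 * (s + real n) + 1) powr \<sigma>) < 2 ^ n * ln 2"
proof -
  define c where "c = (2 * s + 1) / 8"
  obtain N where N: "real N > max (8 powr (1 / (1 - \<sigma>))) (4 * (3 * exp c / ln 2))"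
    using reals_Archimedean2 by blast
  have "3 * exp ((2 * (s + real n) + 1) powr \<sigma>) < 2 ^ n * ln 2" if n: "n \<ge> N" for n
  proof -
    define y where "y = 2 * (s + real n) + 1"
    have y: "y \<ge> 8 powr (1 / (1 - \<sigma>))" using n N s by (simp add: y_def)
    have y0: "y > 0" using s by (simp add: y_def add_nonneg_pos)
    have "8 = (8 powr (1 / (1 - \<sigma>))) powr (1 - \<sigma>)" using \<sigma> by (simp add: powr_powr)
    also have "\<dots> \<le> y powr (1 - \<sigma>)" using y \<sigma> by (intro powr_mono2) auto
    finally have "8 * y powr \<sigma> \<le> y powr (1 - \<sigma>) * y powr \<sigma>" by (intro mult_right_mono) auto
    also have "\<dots> = y" using y0 by (simp add: powr_add[symmetric])
    finally have "y powr \<sigma> \<le> real n / 4 + c" by (simp add: y_def c_def field_simps)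
    then have "3 * exp (y powr \<sigma>) \<le> 3 * exp c * exp (real n / 4)" by (simp add: exp_add[symmetric] add.commute)
    also have "\<dots> < (ln 2 * exp (real n / 4)) * exp (real n / 4)"
    proof (rule mult_strict_right_mono)
      have "3 * exp c / ln 2 < real n / 4" using N n by simp
      also have "\<dots> \<le> exp (real n / 4)" using exp_ge_add_one_self[of "real n / 4"] by linarith
      finally show "3 * exp c < ln 2 * exp (real n / 4)" by (simp add: field_simps)
    qed simp
    also have "\<dots> = ln 2 * exp (real n * (1 / 2))" by (simp add: exp_add[symmetric])
    also have "\<dots> \<le> ln 2 * exp (real n * ln 2)"
    proof -
      have "real n * (1 / 2) \<le> real n * ln 2"
        using ln2_ge_two_thirds by (intro mult_left_mono) linarith+
      then show ?thesis by (intro mult_left_mono) auto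
    qed
    also have "\<dots> = 2 ^ n * ln 2" by (simp add: exp_of_nat_mult)
    finally show ?thesis by (simp add: y_def)
  qed
  then show ?thesis by blast
qed

section \<open>Exponential type and linear growth of T\<close>

context nonzero_entire
begin

lemma countable_zero_radii: "countable (cmod ` {z. f z = 0})"
  by (intro countable_image countable_zeros)

text \<open>Above the threshold \<open>K * exp (b * s)\<close> both \<open>X z\<close> and the
  product of \<open>poly q z\<close> with \<open>f z\<close> are at most a quarter of |f(z)|^2, so
  the remaining term makes |f(z+1)| at least |f(z)|^2 / (2 K1 exp s). Iteration gives log |f(z+n)|
  \<ge> 2^n ln 2, against the Poisson bound at a radius of about 2 |z| + 2n.\<close>

lemma exponential_type:
  assumes ho: "hyper_order f < 1"
    and eq: "\<And>z. (f z)\<^sup>2 + poly q z * (f (z + 1) - f z) = X z"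
    and X: "\<And>z. cmod (X z) \<le> P * exp (a * cmod z)" and a: "a \<ge> 0"
  shows "\<exists>C b. b \<ge> 0 \<and> (\<forall>z. cmod (f z) \<le> C * exp (b * cmod z))"
proof -
  obtain \<sigma> R0 where \<sigma>: "0 < \<sigma>" "\<sigma> < 1" and R0: "\<And>r. r \<ge> R0 \<Longrightarrow> nev_T f r \<le> exp (r powr \<sigma>)"
    using nev_T_le_exp_powr[OF ho] by blast
  obtain K1 where K1: "K1 \<ge> 1" "\<And>z. cmod (poly q z) \<le> K1 * exp (1 * cmod z)"
    using poly_le_exp[of 1 q] by auto
  have P: "P \<ge> 0" using order_trans[OF norm_ge_zero X[of 0]] by simp
  \<comment> \<open>One unit for the growth of \<open>q\<close>, and \<open>a\<close> for that of
    \<open>X\<close>. The parts of \<open>K\<close> make the two smaller terms quarters of |f|^2 and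
    let the threshold at s + 1 be met again after squaring.\<close>
  define b where "b = 1 + a"
  define K where "K = 4 * K1 * exp b + 4 * P + 1"
  have b: "b \<ge> 1" using a by (simp add: b_def)
  have "exp b \<ge> 1" using b by simp
  then have "K1 * 1 \<le> K1 * exp b" using K1 by (intro mult_left_mono) auto
  then have K: "K \<ge> 4 * K1" "K \<ge> 2 * K1 * exp b" "K \<ge> 4 * P" "K \<ge> 1" "K1 * exp b \<ge> 1"
    using P K1(1) unfolding K_def by linarith+
  have KP: "4 * P \<le> K\<^sup>2" using K(3,4) by (metis dual_order.trans power2_eq_square mult_left_mono[of 1 K K] mult_1_right zero_le_one)
  have step: "cmod (f (z + 1)) \<ge> (cmod (f z))\<^sup>2 / (2 * K1 * exp s)"
    if s: "cmod z \<le> s" and big: "cmod (f z) \<ge> K * exp (b * s)" for z s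
  proof -
    have s0: "s \<ge> 0" using s norm_ge_zero[of z] by linarith
    have q: "cmod (poly q z) \<le> K1 * exp s"
      using K1(2)[of z] s K1(1) by (elim order_trans) (auto intro!: mult_left_mono)
    have es: "exp s \<le> exp (b * s)" using mult_right_mono[OF b s0] by simp
    define x where "x = cmod (f z)"
    have x0: "x > 0" using big K(4) unfolding x_def by (elim less_le_trans[rotated]) simp
    have "4 * K1 * exp s \<le> K * exp (b * s)" using K(1) es K1(1) by (intro mult_mono) auto
    then have 1: "4 * (K1 * exp s) * x \<le> x * x"
      using big x0 by (intro mult_right_mono) (auto simp: x_def)
    have "4 * P * exp (a * s) \<le> K\<^sup>2 * exp (b * s + b * s)"
    proof (rule mult_mono[OF KP])
      have "a * s \<le> b * s + b * s" using s0 a by (simp add: b_def algebra_simps)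
      then show "exp (a * s) \<le> exp (b * s + b * s)" by simp
    qed auto
    also have "\<dots> = (K * exp (b * s)) * (K * exp (b * s))" unfolding exp_add power2_eq_square by simp
    also have "\<dots> \<le> x * x" using big K(4) x0 by (intro mult_mono) (auto simp: x_def)
    finally have 2: "4 * (P * exp (a * s)) \<le> x * x" by simp
    have "cmod (X z) \<le> P * exp (a * s)"
      using X[of z] s a P by (elim order_trans) (auto intro!: mult_left_mono)
    moreover have "(f z)\<^sup>2 = X z - poly q z * (f (z + 1) - f z)" using eq[of z] by (simp add: algebra_simps)
    then have "x\<^sup>2 \<le> cmod (X z) + cmod (poly q z) * cmod (f (z + 1) - f z)"
      unfolding x_def by (metis norm_mult norm_power norm_triangle_ineq4)
    moreover have "cmod (poly q z) * cmod (f (z + 1) - f z) \<le> K1 * exp s * (cmod (f (z + 1)) + x)"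
      unfolding x_def by (intro mult_mono q norm_triangle_ineq4) (use K1(1) in auto)
    ultimately have "x * x \<le> P * exp (a * s) + K1 * exp s * cmod (f (z + 1)) + K1 * exp s * x"
      by (simp add: power2_eq_square algebra_simps)
    then have "x * x \<le> 2 * K1 * exp s * cmod (f (z + 1))" using 1 2 by simp
    then show ?thesis using K1(1) by (simp add: x_def[symmetric] power2_eq_square field_simps)
  qed
  have "cmod (f z) \<le> 2 * K * exp (b * cmod z)" for z
  proof (rule ccontr)
    assume "\<not> ?thesis"
    \<comment> \<open>The factor 2 above the threshold is what gets squared: after n steps the
      excess is 2^(2^n).\<close>
    then have start: "cmod (f z) \<ge> 2 * (K * exp (b * cmod z))" by simp
    define s where "s n = cmod z + real n" for n
    have sn: "cmod (z + of_nat n) \<le> s n" for n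
      using norm_triangle_ineq[of z "of_nat n"] by (simp add: s_def)
    have orbit: "cmod (f (z + of_nat n)) \<ge> 2 ^ (2 ^ n) * (K * exp (b * s n))" for n
    proof (induction n)
      case 0
      then show ?case using start by (simp add: s_def)
    next
      case (Suc n)
      define Y :: real where "Y = 2 ^ (2 ^ n)"
      have Y: "Y \<ge> 1" by (simp add: Y_def)
      have s0: "s n \<ge> 0" by (simp add: s_def)
      have YK: "cmod (f (z + of_nat n)) \<ge> Y * (K * exp (b * s n))" using Suc by (simp add: Y_def)
      moreover have "1 * (K * exp (b * s n)) \<le> Y * (K * exp (b * s n))"
        using Y K(4) by (intro mult_right_mono) auto
      ultimately have big: "cmod (f (z + of_nat n)) \<ge> K * exp (b * s n)" by linarith
      have "Y\<^sup>2 * (K * exp (b * s (Suc n))) = Y\<^sup>2 * K * exp (b * s n) * exp b"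
        by (simp add: s_def exp_add[symmetric] algebra_simps)
      also have "\<dots> \<le> (Y * (K * exp (b * s n)))\<^sup>2 / (2 * K1 * exp (s n))"
      proof -
        have "exp (s n) \<le> exp (b * s n)" using mult_right_mono[OF b s0] by simp
        then have "(2 * K1 * exp b) * exp (s n) \<le> K * exp (b * s n)"
          using K(2,4) by (intro mult_mono) auto
        then have "(Y\<^sup>2 * K * exp (b * s n)) * ((2 * K1 * exp b) * exp (s n))
            \<le> (Y\<^sup>2 * K * exp (b * s n)) * (K * exp (b * s n))"
          using K(4) by (intro mult_left_mono) auto
        then show ?thesis using K1(1) by (simp add: field_simps power2_eq_square)
      qed
      also have "\<dots> \<le> (cmod (f (z + of_nat n)))\<^sup>2 / (2 * K1 * exp (s n))"
        using YK Y K K1 by (intro divide_right_mono power_mono) auto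
      also have "\<dots> \<le> cmod (f (z + of_nat n + 1))" by (rule step[OF sn big])
      finally show ?case by (simp add: Y_def power_mult[symmetric] add_ac mult.commute)
    qed
    obtain N where N: "\<And>n. n \<ge> N \<Longrightarrow> 3 * exp ((2 * (cmod z + real n) + 1) powr \<sigma>) < 2 ^ n * ln 2"
      using double_exp_beats_exp_powr[OF \<sigma>, of "cmod z"] by auto
    obtain n where n: "real n > max (real N) R0 " using reals_Archimedean2 by blast
    \<comment> \<open>A zero-free circle of more than twice the radius of the orbit point, as
      \<open>norm_le_exp_nev_T\<close> demands.\<close>
    obtain r where r: "2 * s n < r" "r < 2 * s n + 1" "r \<notin> cmod ` {z. f z = 0}"
      using exists_outside_countable[OF countable_zero_radii] by blast
    have sn_n: "s n \<ge> real n" by (simp add: s_def)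
    have r0: "r > 0" using r(1) sn_n by simp
    have "exp (2 ^ n * ln 2) = (2::real) ^ (2 ^ n)"
      by (metis exp_ln exp_of_nat_mult of_nat_numeral of_nat_power zero_less_numeral)
    then have "exp (2 ^ n * ln 2) = (2::real) ^ (2 ^ n) * 1" by simp
    also have "\<dots> \<le> 2 ^ (2 ^ n) * (K * exp (b * s n))"
    proof (rule mult_left_mono)
      have "1 * 1 \<le> K * exp (b * s n)" using K(4) b by (intro mult_mono) (auto simp: s_def)
      then show "1 \<le> K * exp (b * s n)" by simp
    qed simp
    also have "\<dots> \<le> cmod (f (z + of_nat n))" by (rule orbit)
    also have "\<dots> \<le> exp (3 * nev_T f r)"
      by (rule norm_le_exp_nev_T[OF r0]) (use r sn[of n] in auto)
    also have "\<dots> \<le> exp (3 * exp ((2 * (cmod z + real n) + 1) powr \<sigma>))"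
    proof -
      have "nev_T f r \<le> exp (r powr \<sigma>)" by (rule R0) (use r(1) sn_n n in linarith)
      also have "\<dots> \<le> exp ((2 * (cmod z + real n) + 1) powr \<sigma>)"
        using r(2) r0 \<sigma> by (auto simp: s_def intro!: powr_mono2)
      finally show ?thesis by simp
    qed
    finally have "2 ^ n * ln 2 \<le> 3 * exp ((2 * (cmod z + real n) + 1) powr \<sigma>)" by simp
    then show False using N[of n] n by simp
  qed
  then show ?thesis using b by (intro exI[of _ "2 * K"] exI[of _ b]) auto
qed

text \<open>Evaluate the equation on the ray where the right-hand side has size exp(\<delta>|w|), at
  |w| = r/4, so that \<open>w\<close> and \<open>w + 1\<close> both lie within r/2. The left side is
  at most 3 Q B^2 with B = exp(3 T). \<open>Q\<close> takes half of the exponent, and \<delta> r / 8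
  \<le> 6 T + O(1) is the rate \<delta>/48.\<close>

lemma nev_T_lower:
  assumes eq: "\<And>z. (f z)\<^sup>2 + poly q z * (f (z + 1) - f z) = p1 * exp (\<alpha>1 * z) + p2 * exp (\<alpha>2 * z)"
    and "p1 \<noteq> 0" "p2 \<noteq> 0" "\<alpha>1 \<noteq> 0" "\<alpha>2 \<noteq> 0" "\<alpha>1 \<noteq> \<alpha>2"
  shows "\<exists>\<delta>>0. \<exists>C R. \<forall>r\<ge>R. (\<forall>z. cmod z = r \<longrightarrow> f z \<noteq> 0) \<longrightarrow> \<delta> * r - C \<le> nev_T f r"
proof -
  obtain \<delta> \<kappa> u r0 where \<delta>: "\<delta> > 0" "\<kappa> > 0" "cmod u = 1"
    "\<And>r. r \<ge> r0 \<Longrightarrow> \<kappa> * exp (\<delta> * r) \<le> cmod (p1 * exp (\<alpha>1 * (of_real r * u)) + p2 * exp (\<alpha>2 * (of_real r * u)))"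
    using exponential_sum_lower[OF assms(2-6)] by blast
  obtain K where K: "K \<ge> 1" "\<And>z. cmod (poly q z) \<le> K * exp (\<delta> / 2 * cmod z)"
    using poly_le_exp[of "\<delta> / 2" q] \<delta>(1) by auto
  have "\<delta> / 48 * r - (ln (3 * K) - ln \<kappa>) / 6 \<le> nev_T f r"
    if r: "r \<ge> max 4 (4 * r0)" and nz: "\<And>z. cmod z = r \<Longrightarrow> f z \<noteq> 0" for r
  proof -
    define w where "w = of_real (r / 4) * u"
    have cw: "cmod w = r / 4" using r \<delta>(3) by (simp add: w_def norm_mult)
    define B where "B = exp (3 * nev_T f r)"
    have T0: "nev_T f r \<ge> 0" by (rule nev_T_nonneg)
    have B: "B \<ge> 1" using T0 by (simp add: B_def)
    have r_pos: "r > 0" using r by simp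
    have f1: "cmod (f w) \<le> B" unfolding B_def by (rule norm_le_exp_nev_T[OF r_pos nz]) (use cw r in auto)
    have f2: "cmod (f (w + 1)) \<le> B" unfolding B_def
      by (rule norm_le_exp_nev_T[OF r_pos nz]) (use norm_triangle_ineq[of w 1] cw r in auto)
    define Q where "Q = K * exp (\<delta> / 2 * (r / 4))"
    have Q: "Q \<ge> 1" "cmod (poly q w) \<le> Q"
      using K(2)[of w] mult_mono[of 1 K 1 "exp (\<delta> / 2 * (r / 4))"] K(1) \<delta>(1) r_pos
      by (auto simp: Q_def cw)
    have "\<kappa> * exp (\<delta> * (r / 4)) \<le> cmod ((f w)\<^sup>2 + poly q w * (f (w + 1) - f w))"
      unfolding eq w_def by (rule \<delta>(4)) (use r in auto)
    also have "\<dots> \<le> (cmod (f w))\<^sup>2 + cmod (poly q w) * (cmod (f (w + 1)) + cmod (f w))"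
      by (rule norm_triangle_le) (auto simp: norm_mult norm_power intro!: mult_left_mono norm_triangle_ineq4)
    also have "\<dots> \<le> B\<^sup>2 + Q * (B + B)"
      by (intro add_mono mult_mono power_mono f1 f2 Q(2)) (use Q(1) in auto)
    also have "\<dots> \<le> 3 * Q * B\<^sup>2"
    proof -
      have "B\<^sup>2 * 1 \<le> B\<^sup>2 * Q" using Q(1) by (intro mult_left_mono) auto
      moreover have "Q * (B * 1) \<le> Q * (B * B)" using Q(1) B by (intro mult_left_mono) auto
      ultimately show ?thesis by (simp add: power2_eq_square algebra_simps)
    qed
    finally have "ln (\<kappa> * exp (\<delta> * (r / 4))) \<le> ln (3 * Q * B\<^sup>2)"
      using \<delta>(2) by (intro ln_mono) auto
    moreover have "ln (3 * Q * B\<^sup>2) = ln (3 * K) + \<delta> / 2 * (r / 4) + 6 * nev_T f r"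
    proof -
      have "3 * Q * B\<^sup>2 = (3 * K) * exp (\<delta> / 2 * (r / 4) + 6 * nev_T f r)"
        by (simp add: Q_def B_def exp_add[symmetric] power2_eq_square mult.assoc)
      then have "ln (3 * Q * B\<^sup>2) = ln ((3 * K) * exp (\<delta> / 2 * (r / 4) + 6 * nev_T f r))" by (rule arg_cong)
      also have "\<dots> = ln (3 * K) + ln (exp (\<delta> / 2 * (r / 4) + 6 * nev_T f r))"
        by (rule ln_mult_pos) (use K(1) in auto)
      finally show ?thesis by simp
    qed
    moreover have "ln (\<kappa> * exp (\<delta> * (r / 4))) = ln \<kappa> + \<delta> * (r / 4)" using \<delta>(2) by (simp add: ln_mult_pos)
    ultimately show ?thesis by (simp add: field_simps)
  qed
  moreover have "\<delta> / 48 > 0" using \<delta>(1) by simp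
  ultimately show ?thesis by blast
qed

end

section \<open>Linear differential equations and exponential sums\<close>

text \<open>The operator (d/dz - \<alpha>)(d/dz - \<beta>) in expanded form.\<close>

definition exp_ode :: "complex \<Rightarrow> complex \<Rightarrow> (complex \<Rightarrow> complex) \<Rightarrow> complex \<Rightarrow> complex" where
  "exp_ode \<alpha> \<beta> y z = deriv (deriv y) z - (\<alpha> + \<beta>) * deriv y z + \<alpha> * \<beta> * y z"

lemma entire_has_derivative:
  "y holomorphic_on UNIV \<Longrightarrow> (y has_field_derivative deriv y z) (at z)"
  by (rule holomorphic_derivI[OF _ open_UNIV]) auto

lemma holomorphic_exp_ode:
  assumes "y holomorphic_on UNIV"
  shows "exp_ode \<alpha> \<beta> y holomorphic_on UNIV"
proof -
  have "deriv y holomorphic_on UNIV" "deriv (deriv y) holomorphic_on UNIV"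
    using assms by (auto intro: holomorphic_deriv)
  then show ?thesis unfolding exp_ode_def by (intro holomorphic_intros assms open_UNIV)
qed

lemma exp_ode_diff:
  assumes "u holomorphic_on UNIV" "v holomorphic_on UNIV"
  shows "exp_ode \<alpha> \<beta> (\<lambda>z. u z - v z) z = exp_ode \<alpha> \<beta> u z - exp_ode \<alpha> \<beta> v z"
proof -
  have d: "deriv (\<lambda>z. u z - v z) = (\<lambda>z. deriv u z - deriv v z)"
    if "u holomorphic_on UNIV" "v holomorphic_on UNIV" for u v :: "complex \<Rightarrow> complex"
    by (rule ext, rule DERIV_imp_deriv)
       (use that in \<open>auto intro!: derivative_eq_intros entire_has_derivative\<close>)
  have "deriv u holomorphic_on UNIV" "deriv v holomorphic_on UNIV"
    using assms by (auto intro: holomorphic_deriv)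
  then show ?thesis
    unfolding exp_ode_def d[OF assms] using d[of "deriv u" "deriv v"] by (simp add: algebra_simps)
qed

lemma exp_ode_exponential_sum:
  "exp_ode \<alpha> \<beta> (\<lambda>z. p * exp (\<alpha> * z) + q * exp (\<beta> * z)) z = 0"
proof -
  have d: "deriv (\<lambda>z. p * exp (\<alpha> * z) + q * exp (\<beta> * z)) = (\<lambda>z. (p * \<alpha>) * exp (\<alpha> * z) + (q * \<beta>) * exp (\<beta> * z))" for p q
    by (rule ext, rule DERIV_imp_deriv) (auto intro!: derivative_eq_intros)
  show ?thesis unfolding exp_ode_def d by (simp add: algebra_simps)
qed

text \<open>Cauchy's inequalities on the unit circle turn derivatives into nearby values, so growth
  estimates for \<open>f\<close> itself are enough; the 2 is the factorial of the second
  derivative.\<close>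

lemma norm_exp_ode_le:
  assumes y: "y holomorphic_on UNIV" and M: "\<And>w. cmod (w - z) \<le> 1 \<Longrightarrow> cmod (y w) \<le> M"
  shows "cmod (exp_ode \<alpha> \<beta> y z) \<le> (2 + cmod (\<alpha> + \<beta>) + cmod (\<alpha> * \<beta>)) * M"
proof -
  have C: "cmod ((deriv ^^ n) y z) \<le> fact n * M / 1 ^ n" for n
    by (rule Cauchy_inequality)
       (use y M in \<open>auto intro: holomorphic_on_subset holomorphic_on_imp_continuous_on simp: norm_minus_commute\<close>)
  have "cmod (deriv (deriv y) z) \<le> 2 * M" "cmod (deriv y z) \<le> M" "cmod (y z) \<le> M"
    using C[of 2] C[of 1] C[of 0] by (auto simp: eval_nat_numeral)
  then have "cmod (deriv (deriv y) z) + cmod ((\<alpha> + \<beta>) * deriv y z) + cmod (\<alpha> * \<beta> * y z)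
      \<le> 2 * M + cmod (\<alpha> + \<beta>) * M + cmod (\<alpha> * \<beta>) * M"
    unfolding norm_mult[of "\<alpha> + \<beta>"] norm_mult[of "\<alpha> * \<beta>"] by (intro add_mono mult_left_mono) auto
  moreover have "cmod (exp_ode \<alpha> \<beta> y z) \<le> cmod (deriv (deriv y) z) + cmod ((\<alpha> + \<beta>) * deriv y z) + cmod (\<alpha> * \<beta> * y z)"
    unfolding exp_ode_def
    using norm_triangle_ineq[of "deriv (deriv y) z - (\<alpha> + \<beta>) * deriv y z" "\<alpha> * \<beta> * y z"]
      norm_triangle_ineq4[of "deriv (deriv y) z" "(\<alpha> + \<beta>) * deriv y z"] by linarith
  ultimately show ?thesis by (simp add: algebra_simps)
qed

lemma first_order_ode:
  assumes v: "v holomorphic_on UNIV" "\<And>z. deriv v z = \<alpha> * v z"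
  shows "\<exists>k. \<forall>z. v z = k * exp (\<alpha> * z)"
proof -
  have "((\<lambda>z. v z * exp (- \<alpha> * z)) has_field_derivative 0) (at z)" for z
    by (rule derivative_eq_intros entire_has_derivative[OF v(1)] refl)+ (simp add: v(2))
  then obtain k where k: "\<And>z. v z * exp (- \<alpha> * z) = k"
    using has_field_derivative_zero_constant[of UNIV "\<lambda>z. v z * exp (- \<alpha> * z)"] by auto
  have "v z = k * exp (\<alpha> * z)" for z
    using k[of z] by (simp add: exp_minus field_simps)
  then show ?thesis by blast
qed

text \<open>The two orders of factoring the operator give two first-order equations, y' - \<beta> y
  = k exp(\<alpha> z) and y' - \<alpha> y = l exp(\<beta> z); their difference determines y.\<close>

lemma exp_ode_solution:
  assumes y: "y holomorphic_on UNIV" and ode: "\<And>z. exp_ode \<alpha> \<beta> y z = 0" and ne: "\<alpha> \<noteq> \<beta>"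
  shows "\<exists>C D. \<forall>z. y z = C * exp (\<alpha> * z) + D * exp (\<beta> * z)"
proof -
  have y': "deriv y holomorphic_on UNIV" using y by (auto intro: holomorphic_deriv)
  have first: "\<exists>k. \<forall>z. deriv y z - b * y z = k * exp (a * z)"
    if "\<And>z. deriv (deriv y) z - (a + b) * deriv y z + a * b * y z = 0" for a b
  proof (rule first_order_ode)
    show "(\<lambda>z. deriv y z - b * y z) holomorphic_on UNIV" by (intro holomorphic_intros y y')
    have "((\<lambda>z. deriv y z - b * y z) has_field_derivative deriv (deriv y) z - b * deriv y z) (at z)" for z
      by (auto intro!: derivative_eq_intros entire_has_derivative y y')
    then have d: "deriv (\<lambda>z. deriv y z - b * y z) z = deriv (deriv y) z - b * deriv y z" for z
      by (rule DERIV_imp_deriv)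
    show "deriv (\<lambda>z. deriv y z - b * y z) z = a * (deriv y z - b * y z)" for z
      unfolding d using that[of z] by (simp add: algebra_simps)
  qed
  obtain k where k: "\<And>z. deriv y z - \<beta> * y z = k * exp (\<alpha> * z)"
    using first[of \<alpha> \<beta>] ode by (auto simp: exp_ode_def)
  obtain l where l: "\<And>z. deriv y z - \<alpha> * y z = l * exp (\<beta> * z)"
    using first[of \<beta> \<alpha>] ode by (auto simp: exp_ode_def add.commute mult.commute)
  have "y z = k / (\<alpha> - \<beta>) * exp (\<alpha> * z) + (- l / (\<alpha> - \<beta>)) * exp (\<beta> * z)" for z
  proof -
    have "(\<alpha> - \<beta>) * y z = k * exp (\<alpha> * z) - l * exp (\<beta> * z)"
      unfolding k[symmetric] l[symmetric] by (simp add: algebra_simps)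
    then have "y z = (k * exp (\<alpha> * z) - l * exp (\<beta> * z)) / (\<alpha> - \<beta>)"
      using ne by (simp add: eq_divide_eq mult.commute)
    then show ?thesis by (simp add: diff_divide_distrib)
  qed
  then show ?thesis by blast
qed

text \<open>No branch of the square root is chosen: \<open>f\<close> has no zeros, so
  differentiating the square and dividing by 2 f gives f' = (\<alpha>/2) f.\<close>

lemma square_eq_exponential:
  assumes f: "f holomorphic_on UNIV" and eq: "\<And>z. (f z)\<^sup>2 = C * exp (\<alpha> * z)" and C: "C \<noteq> 0"
  shows "\<exists>c. c\<^sup>2 = C \<and> (\<forall>z. f z = c * exp (\<alpha> * z / 2))"
proof -
  have "deriv f z = (\<alpha> / 2) * f z" for z
  proof -
    have nz: "f z \<noteq> 0" using eq[of z] C by auto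
    have "((\<lambda>z. (f z)\<^sup>2) has_field_derivative 2 * f z * deriv f z) (at z)"
      by (rule derivative_eq_intros entire_has_derivative[OF f] refl)+ simp
    moreover have "((\<lambda>z. (f z)\<^sup>2) has_field_derivative \<alpha> * (C * exp (\<alpha> * z))) (at z)"
      unfolding eq by (rule derivative_eq_intros refl)+ simp
    ultimately have "2 * f z * deriv f z = \<alpha> * (f z)\<^sup>2"
      unfolding eq by (rule DERIV_unique)
    then show ?thesis using nz by (simp add: power2_eq_square field_simps)
  qed
  then obtain c where c: "\<And>z. f z = c * exp (\<alpha> / 2 * z)"
    using first_order_ode[OF f, of "\<alpha> / 2"] by blast
  have "c\<^sup>2 = C" using eq[of 0] c[of 0] by simp
  then show ?thesis using c by (intro exI[of _ c]) (simp add: mult.commute)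
qed

text \<open>With both coefficients nonzero the sum has a zero at which its derivative does not
  vanish, but every zero of a square is multiple.\<close>

lemma square_eq_exponential_sum:
  assumes f: "f holomorphic_on UNIV" and eq: "\<And>z. (f z)\<^sup>2 = C * exp (\<alpha> * z) + D * exp (\<beta> * z)"
    and ne: "\<alpha> \<noteq> \<beta>"
  shows "C = 0 \<or> D = 0"
proof (rule ccontr)
  assume "\<not> ?thesis"
  then have CD: "C \<noteq> 0" "D \<noteq> 0" by auto
  define z where "z = Ln (- D / C) / (\<alpha> - \<beta>)"
  have "exp ((\<alpha> - \<beta>) * z) = - D / C" using CD ne by (simp add: z_def)
  then have rel: "C * exp (\<alpha> * z) = - D * exp (\<beta> * z)"
    using CD by (simp add: left_diff_distrib exp_diff field_simps)
  then have fz: "f z = 0" using eq[of z] by simp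
  have "((\<lambda>z. (f z)\<^sup>2) has_field_derivative 2 * f z * deriv f z) (at z)"
    by (rule derivative_eq_intros entire_has_derivative[OF f] refl)+ simp
  moreover have "((\<lambda>z. (f z)\<^sup>2) has_field_derivative \<alpha> * (C * exp (\<alpha> * z)) + \<beta> * (D * exp (\<beta> * z))) (at z)"
    unfolding eq by (rule derivative_eq_intros refl)+ simp
  ultimately have "2 * f z * deriv f z = \<alpha> * (C * exp (\<alpha> * z)) + \<beta> * (D * exp (\<beta> * z))"
    by (rule DERIV_unique)
  then have "(\<beta> - \<alpha>) * (D * exp (\<beta> * z)) = 0" unfolding rel fz by (auto simp: algebra_simps)
  then show False using ne CD by simp
qed

text \<open>Differentiation preserves the shape and lowers the degree. At degree 0 the derivative
  vanishes identically, and its value and slope at 0 form a Vandermonde system in A \<beta> and B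
  \<gamma>.\<close>

lemma poly_eq_exponential_sum:
  fixes p :: "complex poly"
  assumes "\<And>z. poly p z = A * exp (\<beta> * z) + B * exp (\<gamma> * z)" "\<beta> \<noteq> 0" "\<beta> \<noteq> \<gamma>"
  shows "A = 0 \<and> (B = 0 \<or> \<gamma> = 0)"
  using assms(1)
proof (induction "degree p" arbitrary: p A B rule: less_induct)
  case less
  have d: "poly (pderiv p) z = (A * \<beta>) * exp (\<beta> * z) + (B * \<gamma>) * exp (\<gamma> * z)" for z
  proof (rule DERIV_unique[OF poly_DERIV])
    show "((\<lambda>x. poly p x) has_field_derivative (A * \<beta>) * exp (\<beta> * z) + (B * \<gamma>) * exp (\<gamma> * z)) (at z)"
      unfolding less.prems by (rule derivative_eq_intros refl)+ simp
  qed
  show ?case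
  proof (cases "degree p = 0")
    case False
    then have "degree (pderiv p) < degree p" by (simp add: degree_pderiv)
    from less.hyps[OF this d] show ?thesis using assms(2) by auto
  next
    case True
    then have "pderiv p = 0" by (simp add: pderiv_eq_0_iff)
    then have z: "(A * \<beta>) * exp (\<beta> * z) + (B * \<gamma>) * exp (\<gamma> * z) = 0" for z
      using d[of z] by simp
    have "((\<lambda>z. (A * \<beta>) * exp (\<beta> * z) + (B * \<gamma>) * exp (\<gamma> * z)) has_field_derivative A * \<beta> * \<beta> + B * \<gamma> * \<gamma>) (at 0)"
      by (rule derivative_eq_intros refl)+ simp
    then have 2: "A * \<beta> * \<beta> + B * \<gamma> * \<gamma> = 0" unfolding z by (metis DERIV_const DERIV_unique)
    have 1: "A * \<beta> = - (B * \<gamma>)" using z[of 0] by (simp add: add_eq_0_iff2)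
    have "B * \<gamma> * (\<gamma> - \<beta>) = 0" using 2 unfolding 1 by (simp add: algebra_simps)
    then have "B * \<gamma> = 0" using assms(3) by simp
    then show ?thesis using 1 assms(2) by auto
  qed
qed

text \<open>Dividing the equation by exp(\<alpha> z / 2) exhibits a multiple of \<open>q\<close> as
  a sum of two exponentials. The one with nonzero exponent must drop out, and the coefficient p2
  survives only if the other exponent is 0. Both alternatives of the theorem are instances, with the
  two exponentials exchanged.\<close>

lemma exponential_solution:
  fixes q :: "complex poly"
  assumes f: "\<And>z. f z = c * exp (\<alpha> * z / 2)"
    and eq: "\<And>z. (f z)\<^sup>2 + poly q z * (f (z + 1) - f z) = p1 * exp (\<alpha> * z) + p2 * exp (\<beta> * z)"
    and nz: "p2 \<noteq> 0" "\<alpha> \<noteq> 0" "\<alpha> \<noteq> \<beta>"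
  shows "degree q = 0 \<and> c\<^sup>2 = p1 \<and> c * (exp (\<alpha> / 2) - 1) * coeff q 0 = p2 \<and> \<alpha> = 2 * \<beta>"
proof -
  define k where "k = c * (exp (\<alpha> / 2) - 1)"
  have key: "poly (smult k q) z = (p1 - c\<^sup>2) * exp (\<alpha> / 2 * z) + p2 * exp ((\<beta> - \<alpha> / 2) * z)" for z
  proof -
    define e where "e = exp (\<alpha> / 2 * z)"
    have e: "e \<noteq> 0" "exp (\<alpha> * z / 2) = e" "exp (\<alpha> * (z + 1) / 2) = e * exp (\<alpha> / 2)" "exp (\<alpha> * z) = e * e"
      by (simp_all add: e_def exp_add[symmetric] algebra_simps add_divide_distrib)
    have b: "exp (\<beta> * z) = exp ((\<beta> - \<alpha> / 2) * z) * e"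
      by (simp add: e_def exp_add[symmetric] algebra_simps)
    have "(k * poly q z) * e = ((p1 - c\<^sup>2) * e + p2 * exp ((\<beta> - \<alpha> / 2) * z)) * e"
      using eq[of z] unfolding f e b k_def by (simp add: algebra_simps power2_eq_square)
    then show ?thesis using e(1) by (simp add: e_def)
  qed
  have ab: "\<alpha> / 2 \<noteq> \<beta> - \<alpha> / 2" using nz(3) by (auto simp: field_simps)
  then have A: "p1 - c\<^sup>2 = 0" and g: "\<beta> - \<alpha> / 2 = 0"
    using poly_eq_exponential_sum[OF key _ ab] nz by auto
  have "poly (smult k q) z = poly [:p2:] z" for z using key[of z] A g by simp
  then have kq: "smult k q = [:p2:]" by (subst poly_eq_poly_eq_iff[symmetric]) (rule ext)
  then have "k \<noteq> 0" using nz(1) by auto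
  then have "degree q = 0" using arg_cong[OF kq, of degree] by simp
  moreover have "k * coeff q 0 = p2" using arg_cong[OF kq, of "\<lambda>p. coeff p 0"] by simp
  ultimately show ?thesis using A g by (auto simp: k_def field_simps)
qed

section \<open>Vanishing of the differential operator on the square\<close>

lemma linear_beats_sqrt:
  fixes a b d :: real
  assumes "d > 0"
  shows "\<exists>R. \<forall>r\<ge>R. a + b * sqrt r < d * r"
proof (intro exI allI impI)
  define m where "m = max 1 ((\<bar>a\<bar> + \<bar>b\<bar>) / d + 1)"
  fix r :: real assume "r \<ge> m\<^sup>2"
  then have "sqrt (m\<^sup>2) \<le> sqrt r" by (rule real_sqrt_le_mono)
  then have m: "m \<le> sqrt r" by (simp add: m_def)
  have r: "sqrt r * sqrt r = r" using \<open>r \<ge> m\<^sup>2\<close> by (simp add: order_trans[OF zero_le_power2])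
  have s: "1 \<le> sqrt r" "(\<bar>a\<bar> + \<bar>b\<bar>) / d < sqrt r" using m by (auto simp: m_def)
  then have "\<bar>a\<bar> + \<bar>b\<bar> < d * sqrt r" using assms by (simp add: field_simps)
  then have "(\<bar>a\<bar> + \<bar>b\<bar>) * sqrt r < (d * sqrt r) * sqrt r" using s(1) by (intro mult_strict_right_mono) auto
  moreover have "a + b * sqrt r \<le> \<bar>a\<bar> * sqrt r + \<bar>b\<bar> * sqrt r"
  proof (rule add_mono)
    have "\<bar>a\<bar> * 1 \<le> \<bar>a\<bar> * sqrt r" using s(1) by (intro mult_left_mono) auto
    then show "a \<le> \<bar>a\<bar> * sqrt r" by linarith
    show "b * sqrt r \<le> \<bar>b\<bar> * sqrt r" using s(1) by (intro mult_right_mono) auto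
  qed
  ultimately have "a + b * sqrt r < d * (sqrt r * sqrt r)" by (simp only: mult.assoc distrib_right)
  then show "a + b * sqrt r < d * r" by (simp only: r)
qed

context nonzero_entire
begin

text \<open>With x = log |f(z)| the two expressions for \<open>W\<close> bound log |W| by 2x and by
  x, up to the same error. Their minimum is 2x - max 0 x, one continuous function whose mean
  consists of a Jensen term and T, so the circle need not be split.\<close>

lemma exp_ode_square_bound:
  assumes h: "\<And>z. h z = poly q z * (f (z + 1) - f z)"
    and W: "exp_ode \<alpha> \<beta> (\<lambda>z. (f z)\<^sup>2) z = - exp_ode \<alpha> \<beta> h z"
    and q: "\<And>z. cmod (poly q z) \<le> K * exp (\<epsilon> * cmod z)" "K \<ge> 1" "\<epsilon> \<ge> 0"
    and G: "G \<ge> 0" "\<And>w. cmod (w - z) \<le> 2 \<Longrightarrow> cmod (f w) \<le> exp G * cmod (f z)"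
    and nz: "f z \<noteq> 0" "exp_ode \<alpha> \<beta> (\<lambda>z. (f z)\<^sup>2) z \<noteq> 0"
  shows "ln (cmod (exp_ode \<alpha> \<beta> (\<lambda>z. (f z)\<^sup>2) z)) \<le>
    (ln (2 + cmod (\<alpha> + \<beta>) + cmod (\<alpha> * \<beta>)) + ln (2 * K) + \<epsilon> * (cmod z + 1)) + 2 * G
      + 2 * ln (cmod (f z)) - max 0 (ln (cmod (f z)))"
proof -
  define c where "c = 2 + cmod (\<alpha> + \<beta>) + cmod (\<alpha> * \<beta>)"
  define U where "U = cmod (exp_ode \<alpha> \<beta> (\<lambda>z. (f z)\<^sup>2) z)"
  define x where "x = ln (cmod (f z))"
  have c: "c \<ge> 2" by (simp add: c_def)
  have U: "U > 0" using nz by (simp add: U_def)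
  have fz: "cmod (f z) = exp x" using nz by (simp add: x_def)
  have "U \<le> c * (exp G * exp x)\<^sup>2"
    unfolding U_def c_def
  proof (rule norm_exp_ode_le)
    show "(\<lambda>z. (f z)\<^sup>2) holomorphic_on UNIV" by (intro holomorphic_intros holo)
    fix w assume "cmod (w - z) \<le> 1"
    then show "cmod ((f w)\<^sup>2) \<le> (exp G * exp x)\<^sup>2"
      using G(2)[of w] fz by (auto simp: norm_power intro!: power_mono)
  qed
  then have "U \<le> c * exp (2 * G + 2 * x)" by (simp add: power2_eq_square exp_add[symmetric])
  then have "ln U \<le> ln (c * exp (2 * G + 2 * x))" using U by (intro ln_mono) auto
  also have "\<dots> = ln c + (2 * G + 2 * x)" using c by (simp add: ln_mult_pos)
  finally have b1: "ln U \<le> ln c + 2 * G + 2 * x" by simp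
  define s where "s = \<epsilon> * (cmod z + 1)"
  have "U = cmod (exp_ode \<alpha> \<beta> h z)" unfolding U_def W by simp
  also have "\<dots> \<le> c * (K * exp s * (exp G * exp x + exp G * exp x))"
    unfolding c_def
  proof (rule norm_exp_ode_le)
    show "h holomorphic_on UNIV"
    proof -
      have "(\<lambda>z. f (z + 1)) holomorphic_on UNIV"
        by (intro holomorphic_on_compose_gen[OF _ holo, unfolded o_def] holomorphic_intros) auto
      then show ?thesis unfolding h[abs_def] by (intro holomorphic_intros holo)
    qed
    fix w assume w: "cmod (w - z) \<le> 1"
    have "cmod (poly q w) \<le> K * exp s"
    proof -
      have "cmod w \<le> cmod z + 1" using norm_triangle_ineq2[of w z] w by linarith
      then have "\<epsilon> * cmod w \<le> s" unfolding s_def using q(3) by (rule mult_left_mono)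
      then have "K * exp (\<epsilon> * cmod w) \<le> K * exp s" using q(2) by (intro mult_left_mono) auto
      then show ?thesis using q(1)[of w] by linarith
    qed
    moreover have "cmod (f (w + 1) - f w) \<le> exp G * exp x + exp G * exp x"
    proof -
      have "cmod (w + 1 - z) \<le> 2" using norm_triangle_ineq[of "w - z" 1] w by (simp add: algebra_simps)
      then show ?thesis
        using norm_triangle_ineq4[of "f (w + 1)" "f w"] G(2)[of "w + 1"] G(2)[of w] w fz by simp
    qed
    ultimately show "cmod (h w) \<le> K * exp s * (exp G * exp x + exp G * exp x)"
      unfolding h norm_mult by (intro mult_mono) (use q(2) in auto)
  qed
  also have "\<dots> = c * ((2 * K) * exp (s + G + x))" by (simp add: exp_add)
  finally have "ln U \<le> ln (c * ((2 * K) * exp (s + G + x)))" using U by (intro ln_mono) auto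
  also have "\<dots> = ln c + (ln (2 * K) + ln (exp (s + G + x)))"
    using c q(2) by (subst ln_mult_pos, simp, simp, subst ln_mult_pos) auto
  finally have b2: "ln U \<le> ln c + ln (2 * K) + s + G + x" by simp
  have "ln (2 * K) \<ge> 0" "s \<ge> 0" using q by (auto simp: s_def)
  then have "ln U \<le> (ln c + ln (2 * K) + s) + 2 * G + 2 * x - max 0 x"
    using b1 b2 G(1) by (auto simp: max_def)
  then show ?thesis by (simp add: U_def c_def s_def x_def)
qed

lemma exp_ode_square_eq_0:
  assumes eq: "\<And>z. (f z)\<^sup>2 + poly q z * (f (z + 1) - f z) = p1 * exp (\<alpha>1 * z) + p2 * exp (\<alpha>2 * z)"
    and nz: "p1 \<noteq> 0" "p2 \<noteq> 0" "\<alpha>1 \<noteq> 0" "\<alpha>2 \<noteq> 0" "\<alpha>1 \<noteq> \<alpha>2"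
    and ho: "hyper_order f < 1" and small: "small_wrt (nev_N_zeros f) f"
  shows "exp_ode \<alpha>1 \<alpha>2 (\<lambda>z. (f z)\<^sup>2) z = 0"
proof (rule ccontr)
  assume W0: "\<not> ?thesis"
  define W where "W = exp_ode \<alpha>1 \<alpha>2 (\<lambda>z. (f z)\<^sup>2)"
  define h where "h = (\<lambda>z. poly q z * (f (z + 1) - f z))"
  have Wh: "W z = - exp_ode \<alpha>1 \<alpha>2 h z" for z
  proof -
    have sq: "(\<lambda>z. (f z)\<^sup>2) = (\<lambda>z. (p1 * exp (\<alpha>1 * z) + p2 * exp (\<alpha>2 * z)) - h z)"
      unfolding eq[symmetric] by (simp add: h_def)
    have "(\<lambda>z. f (z + 1)) holomorphic_on UNIV"
      by (intro holomorphic_on_compose_gen[OF _ holo, unfolded o_def] holomorphic_intros) auto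
    then have "h holomorphic_on UNIV" unfolding h_def by (intro holomorphic_intros holo)
    then show ?thesis
      unfolding W_def sq
      by (subst exp_ode_diff) (auto simp: exp_ode_exponential_sum intro!: holomorphic_intros)
  qed
  interpret W: nonzero_entire W
  proof
    show "W holomorphic_on UNIV"
      unfolding W_def by (intro holomorphic_exp_ode holomorphic_intros holo)
    show "\<exists>w. W w \<noteq> 0" using W0 by (auto simp: W_def)
  qed
  define a where "a = max (cmod \<alpha>1) (cmod \<alpha>2)"
  have X: "cmod (p1 * exp (\<alpha>1 * z) + p2 * exp (\<alpha>2 * z)) \<le> (cmod p1 + cmod p2) * exp (a * cmod z)" for z
  proof -
    have e: "cmod (exp (\<alpha> * z)) \<le> exp (a * cmod z)" if "cmod \<alpha> \<le> a" for \<alpha>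
    proof -
      have "cmod (exp (\<alpha> * z)) = exp (Re (\<alpha> * z))" by (rule norm_exp_eq_Re)
      also have "Re (\<alpha> * z) \<le> cmod \<alpha> * cmod z" using complex_Re_le_cmod[of "\<alpha> * z"] by (simp add: norm_mult)
      also have "\<dots> \<le> a * cmod z" using that by (intro mult_right_mono) auto
      finally show ?thesis by simp
    qed
    have "cmod (p1 * exp (\<alpha>1 * z) + p2 * exp (\<alpha>2 * z)) \<le> cmod p1 * cmod (exp (\<alpha>1 * z)) + cmod p2 * cmod (exp (\<alpha>2 * z))"
      by (rule norm_triangle_le) (simp add: norm_mult)
    also have "\<dots> \<le> cmod p1 * exp (a * cmod z) + cmod p2 * exp (a * cmod z)"
      by (intro add_mono mult_left_mono e) (auto simp: a_def)
    finally show ?thesis by (simp add: algebra_simps)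
  qed
  obtain C b where Cb: "b \<ge> 0" "\<And>z. cmod (f z) \<le> C * exp (b * cmod z)"
    using exponential_type[OF ho eq X] by (auto simp: a_def le_max_iff_disj)
  obtain A where A: "A \<ge> 0" "\<forall>r\<ge>2. \<exists>R\<ge>r. real (\<Sum>a\<in>zeros_upto f R. zero_mult f a) \<le> A * r \<and>
    (\<forall>z w. cmod z = r \<longrightarrow> cmod (w - z) \<le> 2 \<longrightarrow> f z \<noteq> 0 \<longrightarrow>
      cmod (f w) \<le> exp (A + (\<Sum>a\<in>zeros_upto f R. zero_mult f a * ln (1 + 2 / cmod (z - a)))) * cmod (f z))"
    using local_growth[OF Cb(2,1)] by blast
  obtain \<delta> CT RT where \<delta>: "\<delta> > 0"
    "\<And>r. r \<ge> RT \<Longrightarrow> \<forall>z. cmod z = r \<longrightarrow> f z \<noteq> 0 \<Longrightarrow> \<delta> * r - CT \<le> nev_T f r"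
    using nev_T_lower[OF eq nz] by blast
  \<comment> \<open>Half of T grows at rate \<delta>/2; letting \<open>q\<close> consume \<delta>/8
    leaves 3\<delta>/8.\<close>
  obtain K where K: "K \<ge> 1" "\<And>z. cmod (poly q z) \<le> K * exp (\<delta> / 8 * cmod z)"
    using poly_le_exp[of "\<delta> / 8" q] \<delta>(1) by auto
  obtain CF where CF: "\<forall>r>0. (\<forall>z. cmod z = r \<longrightarrow> f z \<noteq> 0) \<longrightarrow>
      circle_mean (\<lambda>z. ln (cmod (f z))) r = nev_N_zeros f r + CF"
    by (rule Jensen) blast
  obtain CW where CW: "\<forall>r>0. (\<forall>z. cmod z = r \<longrightarrow> W z \<noteq> 0) \<longrightarrow>
      circle_mean (\<lambda>z. ln (cmod (W z))) r = nev_N_zeros W r + CW"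
    by (rule W.Jensen) blast
  obtain E where E: "finite_log_measure E"
    "\<And>\<epsilon>. \<epsilon> > 0 \<Longrightarrow> \<exists>R. \<forall>r\<ge>R. r \<notin> E \<longrightarrow> \<bar>nev_N_zeros f r\<bar> \<le> \<epsilon> * nev_T f r"
    using small unfolding small_wrt_def by blast
  \<comment> \<open>The mean of 2 log |f| brings in 2 N, so 1/4 costs half of T.\<close>
  obtain RN where RN: "\<And>r. r \<ge> RN \<Longrightarrow> r \<notin> E \<Longrightarrow> \<bar>nev_N_zeros f r\<bar> \<le> 1 / 4 * nev_T f r"
    using E(2)[of "1/4"] by auto
  define c1 where "c1 = ln (2 + cmod (\<alpha>1 + \<alpha>2) + cmod (\<alpha>1 * \<alpha>2)) + ln (2 * K)"
  define c3 where "c3 = c1 + \<delta> / 8 + 2 * A + 2 * CF - CW + CT / 2"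
  obtain RL where RL: "\<And>r. r \<ge> RL \<Longrightarrow> c3 + (512 * A) * sqrt r < (3 * \<delta> / 8) * r"
    using linear_beats_sqrt[of "3 * \<delta> / 8" c3 "512 * A"] \<delta>(1) by auto
  have "countable (cmod ` {z. f z = 0} \<union> cmod ` {z. W z = 0})"
    using countable_zero_radii W.countable_zero_radii by blast
  then obtain r where r: "r \<ge> Max {2, RT, RN, RL}" "r \<notin> E"
      "r \<notin> cmod ` {z. f z = 0} \<union> cmod ` {z. W z = 0}"
    using exists_outside_finite_log_measure[OF E(1)] by blast
  have rs: "r \<ge> 2" "r \<ge> RT" "r \<ge> RN" "r \<ge> RL" using r(1) by auto
  have fnz: "f z \<noteq> 0" and Wnz: "W z \<noteq> 0" if "cmod z = r" for z using that r(3) by auto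
  obtain R where R: "R \<ge> r" "real (\<Sum>a\<in>zeros_upto f R. zero_mult f a) \<le> A * r"
    "\<And>z w. cmod z = r \<Longrightarrow> cmod (w - z) \<le> 2 \<Longrightarrow> f z \<noteq> 0 \<Longrightarrow>
      cmod (f w) \<le> exp (A + (\<Sum>a\<in>zeros_upto f R. zero_mult f a * ln (1 + 2 / cmod (z - a)))) * cmod (f z)"
    using A(2) rs(1) by blast
  define Z where "Z = zeros_upto f R"
  have Zr: "cmod a \<noteq> r" if "a \<in> Z" for a using that fnz by (auto simp: Z_def zeros_upto_def)
  define G where "G z = A + (\<Sum>a\<in>Z. zero_mult f a * ln (1 + 2 / cmod (z - a)))" for z
  have G0: "G z \<ge> 0" for z
    unfolding G_def by (intro add_nonneg_nonneg A(1) sum_nonneg mult_nonneg_nonneg ln_ge_zero) auto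
  have contG1: "continuous_on (sphere 0 r) (\<lambda>z. zero_mult f a * ln (1 + 2 / cmod (z - a)))" if "a \<in> Z" for a
    by (intro continuous_intros continuous_on_ln_one_plus_inverse_dist Zr that)
  have contG: "continuous_on (sphere 0 r) G"
    unfolding G_def by (intro continuous_on_add continuous_on_const continuous_on_sum contG1)
  \<comment> \<open>At most A r zeros, each with mean at most 256 / sqrt r.\<close>
  have meanG: "circle_mean G r \<le> A + 256 * A * sqrt r"
  proof -
    have "circle_mean G r = A + (\<Sum>a\<in>Z. zero_mult f a * circle_mean (\<lambda>z. ln (1 + 2 / cmod (z - a))) r)"
      unfolding G_def
      by (subst circle_mean_add)
         (use rs contG1 in \<open>auto intro!: continuous_on_sum simp: circle_mean_sum circle_mean_cmult\<close>)
    also have "(\<Sum>a\<in>Z. zero_mult f a * circle_mean (\<lambda>z. ln (1 + 2 / cmod (z - a))) r)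
        \<le> (\<Sum>a\<in>Z. zero_mult f a * (256 / sqrt r))"
      by (intro sum_mono mult_left_mono circle_mean_ln_one_plus_inverse_dist Zr) (use rs in auto)
    also have "\<dots> = real (\<Sum>a\<in>Z. zero_mult f a) * (256 / sqrt r)" by (simp only: of_nat_sum sum_distrib_right)
    also have "\<dots> \<le> A * r * (256 / sqrt r)"
      using R(2) rs by (intro mult_right_mono) (auto simp: Z_def)
    also have "\<dots> = 256 * A * (r / sqrt r)" by simp
    also have "r / sqrt r = sqrt r" using rs by (simp add: real_div_sqrt)
    finally show ?thesis by simp
  qed
  have contf: "continuous_on (sphere 0 r) (\<lambda>z. ln (cmod (f z)))" by (rule continuous_ln_circle[OF fnz])
  have contW: "continuous_on (sphere 0 r) (\<lambda>z. ln (cmod (W z)))" by (rule W.continuous_ln_circle[OF Wnz])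
  define k where "k = c1 + \<delta> / 8 * (r + 1)"
  have "circle_mean (\<lambda>z. ln (cmod (W z)) + max 0 (ln (cmod (f z)))) r \<le>
        circle_mean (\<lambda>z. k + (2 * G z + 2 * ln (cmod (f z)))) r"
  proof (rule circle_mean_mono)
    fix z assume z: "cmod z = r"
    have "ln (cmod (W z)) \<le> (ln (2 + cmod (\<alpha>1 + \<alpha>2) + cmod (\<alpha>1 * \<alpha>2)) + ln (2 * K) + \<delta> / 8 * (cmod z + 1)) + 2 * G z
      + 2 * ln (cmod (f z)) - max 0 (ln (cmod (f z)))"
      unfolding W_def
    proof (rule exp_ode_square_bound[where h = h and q = q])
      show "cmod (f w) \<le> exp (G z) * cmod (f z)" if "cmod (w - z) \<le> 2" for w
        using R(3)[OF z that fnz[OF z]] by (simp add: G_def Z_def)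
    qed (use Wh Wnz[OF z] fnz[OF z] K G0 \<delta>(1) in \<open>auto simp: h_def W_def\<close>)
    then show "ln (cmod (W z)) + max 0 (ln (cmod (f z))) \<le> k + (2 * G z + 2 * ln (cmod (f z)))"
      by (simp add: k_def c1_def z)
  qed (use rs in \<open>auto intro!: continuous_on_add continuous_on_max continuous_on_mult continuous_on_const contf contW contG\<close>)
  moreover have "circle_mean (\<lambda>z. ln (cmod (W z)) + max 0 (ln (cmod (f z)))) r
      = circle_mean (\<lambda>z. ln (cmod (W z))) r + nev_T f r"
    unfolding nev_T_eq_circle_mean
    by (rule circle_mean_add) (use rs in \<open>auto intro!: continuous_on_max continuous_on_const contf contW\<close>)
  moreover have "circle_mean (\<lambda>z. k + (2 * G z + 2 * ln (cmod (f z)))) r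
      = k + (2 * circle_mean G r + 2 * circle_mean (\<lambda>z. ln (cmod (f z))) r)"
  proof -
    have "circle_mean (\<lambda>z. k + (2 * G z + 2 * ln (cmod (f z)))) r
       = circle_mean (\<lambda>z. k) r + circle_mean (\<lambda>z. 2 * G z + 2 * ln (cmod (f z))) r"
      by (rule circle_mean_add) (use rs in \<open>auto intro!: continuous_on_add continuous_on_mult continuous_on_const contf contG\<close>)
    also have "circle_mean (\<lambda>z. 2 * G z + 2 * ln (cmod (f z))) r
       = circle_mean (\<lambda>z. 2 * G z) r + circle_mean (\<lambda>z. 2 * ln (cmod (f z))) r"
      by (rule circle_mean_add) (use rs in \<open>auto intro!: continuous_on_mult continuous_on_const contf contG\<close>)
    finally show ?thesis by (simp only: circle_mean_const circle_mean_cmult)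
  qed
  \<comment> \<open>\<open>W\<close> enters from below, so its zeros can only help: their counting
    function is nonnegative for r \<ge> 1.\<close>
  moreover have "circle_mean (\<lambda>z. ln (cmod (W z))) r \<ge> CW"
    using CW rs(1) Wnz W.nev_N_zeros_nonneg[of r] by simp
  moreover have "circle_mean (\<lambda>z. ln (cmod (f z))) r \<le> 1 / 4 * nev_T f r + CF"
    using CF rs(1) fnz RN[OF rs(3) r(2)] by simp
  moreover define s where "s = A * sqrt r"
  moreover have "circle_mean G r \<le> A + 256 * s" using meanG by (simp add: s_def)
  ultimately have "CW + nev_T f r \<le> k + 2 * (A + 256 * s) + 2 * (1 / 4 * nev_T f r + CF)"
    by argo
  moreover have "\<delta> * r - CT \<le> nev_T f r" using \<delta>(2) rs(2) fnz by blast
  ultimately have "(3 * \<delta> / 8) * r \<le> c3 + 512 * s"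
    unfolding c3_def k_def by (simp add: field_simps)
  then have "(3 * \<delta> / 8) * r \<le> c3 + (512 * A) * sqrt r" by (simp add: s_def)
  then show False using RL[OF rs(4)] by simp
qed

end

theorem theorem1p3:
  fixes q :: "complex poly" and p1 p2 \<alpha>1 \<alpha>2 :: complex and f :: "complex \<Rightarrow> complex"
  assumes "p1 \<noteq> 0" and "p2 \<noteq> 0" and "\<alpha>1 \<noteq> 0" and "\<alpha>2 \<noteq> 0" and "\<alpha>1 \<noteq> \<alpha>2"
    and "f holomorphic_on UNIV"
    and "hyper_order f < 1"
    and "\<forall>z. (f z)\<^sup>2 + poly q z * (f (z + 1) - f z) = p1 * exp (\<alpha>1 * z) + p2 * exp (\<alpha>2 * z)"
    and "small_wrt (nev_N_zeros f) f"
  shows "degree q = 0 \<and>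
    ((\<exists>c1. (\<forall>z. f z = c1 * exp (\<alpha>1 * z / 2)) \<and> c1\<^sup>2 = p1 \<and>
           c1 * (exp (\<alpha>1 / 2) - 1) * coeff q 0 = p2 \<and> \<alpha>1 = 2 * \<alpha>2) \<or>
     (\<exists>c2. (\<forall>z. f z = c2 * exp (\<alpha>2 * z / 2)) \<and> c2\<^sup>2 = p2 \<and>
           c2 * (exp (\<alpha>2 / 2) - 1) * coeff q 0 = p1 \<and> \<alpha>2 = 2 * \<alpha>1))"
proof -
  have eq: "(f z)\<^sup>2 + poly q z * (f (z + 1) - f z) = p1 * exp (\<alpha>1 * z) + p2 * exp (\<alpha>2 * z)" for z
    using assms(8) by blast
  have "\<exists>w. f w \<noteq> 0"
  proof (rule ccontr)
    assume "\<not> ?thesis"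
    then have "p1 * exp (\<alpha>1 * z) + p2 * exp (\<alpha>2 * z) = 0" for z using eq[of z] by simp
    then show False
      using exponential_sum_lower[OF assms(1-5)]
      by (metis exp_gt_zero less_le_not_le mult_pos_pos norm_zero order_refl)
  qed
  with assms(6) interpret nonzero_entire f by unfold_locales
  have ode: "exp_ode \<alpha>1 \<alpha>2 (\<lambda>z. (f z)\<^sup>2) z = 0" for z
    by (rule exp_ode_square_eq_0[OF eq assms(1-5,7,9)])
  obtain C D where CD: "\<And>z. (f z)\<^sup>2 = C * exp (\<alpha>1 * z) + D * exp (\<alpha>2 * z)"
    using exp_ode_solution[OF _ ode assms(5)] holo by (auto intro: holomorphic_intros)
  consider "C = 0" "D \<noteq> 0" | "D = 0" "C \<noteq> 0"
    using square_eq_exponential_sum[OF holo CD assms(5)] CD nonzero by force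
  then show ?thesis
  proof cases
    case 1
    then obtain c where c: "\<And>z. f z = c * exp (\<alpha>2 * z / 2)"
      using square_eq_exponential[OF holo, of D \<alpha>2] CD by auto
    have "(f z)\<^sup>2 + poly q z * (f (z + 1) - f z) = p2 * exp (\<alpha>2 * z) + p1 * exp (\<alpha>1 * z)" for z
      using eq[of z] by simp
    then have "degree q = 0 \<and> c\<^sup>2 = p2 \<and> c * (exp (\<alpha>2 / 2) - 1) * coeff q 0 = p1 \<and> \<alpha>2 = 2 * \<alpha>1"
      by (rule exponential_solution[OF c]) (use assms in auto)
    then show ?thesis using c by blast
  next
    case 2
    then obtain c where c: "\<And>z. f z = c * exp (\<alpha>1 * z / 2)"
      using square_eq_exponential[OF holo, of C \<alpha>1] CD by auto
    have "degree q = 0 \<and> c\<^sup>2 = p1 \<and> c * (exp (\<alpha>1 / 2) - 1) * coeff q 0 = p2 \<and> \<alpha>1 = 2 * \<alpha>2"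
      by (rule exponential_solution[OF c eq]) (use assms in auto)
    then show ?thesis using c by blast
  qed
qed

end
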